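(* Let $r\geq 2$ be an integer, let $\omega_r=e^{2\pi i/r}$, let $p\in[1,2]$ and let $A_0,\ldots,A_{r-1}\in\mathbb{C}^{n\times n}$. Set $\zeta_{p,r}:=\frac{(p-1)(1-(p-1)^{r-1})}{(r-1)(2-p)}$. Then \[ \left(\frac{1}{r}\sum_{j=0}^{r-1}\|A_j\|_p^p\right)^{2/p}\geq \left\|\frac{1}{r}\sum_{j=0}^{r-1}A_j\right\|_p^2+\zeta_{p,r}\sum_{k=1}^{r-1}\left\|\frac{1}{r}\sum_{j=0}^{r-1}\omega_r^{-jk}A_j\right\|_p^2, \] and equivalently \[ \left(\frac{1}{r}\sum_{k=0}^{r-1}\left\|\sum_{j=0}^{r-1}\omega_r^{jk}A_j\right\|_p^p\right)^{2/p}\geq \|A_0\|_p^2+\zeta_{p,r}\sum_{k=1}^{r-1}\|A_k\|_p^2 . \]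
   Context: For a matrix $M$, $\|M\|_p=(\operatorname{Tr}|M|^p)^{1/p}=(\sum_i\sigma_i(M)^p)^{1/p}$ is the (unnormalized) Schatten $p$-norm, where $\sigma_i(M)$ are the singular values of $M$ and $|M|=\sqrt{M^\dagger M}$. At $p=2$ the expression $\zeta_{p,r}$ is understood as its limit value $1$ as $p\to 2$. *)

theory Defs
  imports
    Complex_Main
    "Jordan_Normal_Form.Schur_Decomposition"
begin

text \<open>
  The eigenvalues of \<open>mat_adjoint M * M\<close>, taken with algebraic multiplicity, are real and
  nonnegative, so passing to the real part below loses nothing.
\<close>

definition singular_values :: "complex mat \<Rightarrow> real multiset" where
  "singular_values M =
     image_mset (\<lambda>x. sqrt (Re x)) (proots (char_poly (mat_adjoint M * M)))"

text \<open>
  Unnormalized: there is no factor depending on the dimension. Since \<open>0 powr p = 0\<close>,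
  vanishing singular values contribute nothing.
\<close>

definition schatten_norm :: "real \<Rightarrow> complex mat \<Rightarrow> real" where
  "schatten_norm p M = (\<Sum>\<sigma>\<in>#singular_values M. \<sigma> powr p) powr (1 / p)"

definition root_of_unity :: "nat \<Rightarrow> complex" where
  "root_of_unity r = exp (2 * of_real pi * \<i> / of_nat r)"

abbreviation mat_sum :: "nat \<Rightarrow> (nat \<Rightarrow> complex mat) \<Rightarrow> nat set \<Rightarrow> complex mat" where
  "mat_sum n F J \<equiv> finsum (module_mat TYPE(complex) n n) F J"

text \<open>The value at \<open>p = 2\<close> is the limit of the quotient, see \<open>zeta_tendsto\<close>.\<close>

definition zeta :: "real \<Rightarrow> nat \<Rightarrow> real" where
  "zeta p r =
     (if p = 2 then 1
      else (p - 1) * (1 - (p - 1) ^ (r - 1)) / (real (r - 1) * (2 - p)))"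

lemma zeta_tendsto:
  assumes "r \<ge> 2"
  shows "((\<lambda>p. (p - 1) * (1 - (p - 1) ^ (r - 1)) / (real (r - 1) * (2 - p))) \<longlongrightarrow> zeta 2 r)
           (at 2)"
proof -
  have r: "real (r - 1) \<noteq> 0"
    using assms by simp
  have "((\<lambda>p::real. (p - 1) * (\<Sum>i<r - 1. (p - 1) ^ i) / real (r - 1)) \<longlongrightarrow>
          (2 - 1) * (\<Sum>i<r - 1. (2 - 1) ^ i) / real (r - 1)) (at 2)"
    using r by (intro tendsto_intros)
  moreover have "(2 - 1) * (\<Sum>i<r - 1. (2 - 1 :: real) ^ i) / real (r - 1) = zeta 2 r"
    using r by (simp add: zeta_def)
  moreover have "\<forall>\<^sub>F p in at 2. (p - 1) * (\<Sum>i<r - 1. (p - 1) ^ i) / real (r - 1)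
      = (p - 1) * (1 - (p - 1) ^ (r - 1)) / (real (r - 1) * (2 - p))"
    unfolding eventually_at_filter
  proof (intro always_eventually allI impI)
    fix p :: real
    assume "p \<noteq> 2"
    have "1 - (p - 1) ^ (r - 1) = (2 - p) * (\<Sum>i<r - 1. (p - 1) ^ i)"
      using one_diff_power_eq[of "p - 1" "r - 1"] by simp
    with \<open>p \<noteq> 2\<close> show "(p - 1) * (\<Sum>i<r - 1. (p - 1) ^ i) / real (r - 1)
      = (p - 1) * (1 - (p - 1) ^ (r - 1)) / (real (r - 1) * (2 - p))"
      by simp
  qed
  ultimately show ?thesis
    using tendsto_cong by fastforce
qed

end

theory Submission
  imports
    "HOL-Analysis.Equivalence_Lebesgue_Henstock_Integration"
    "HOL-Analysis.Complex_Transcendental"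
    Defs
begin

text \<open>
  Write \<open>\<psi> M = \<parallel>M\<parallel>\<^sub>p\<^sup>p\<close> and let \<open>G M\<close> be \<open>1/p\<close> times its gradient. The heart of the proof is a strong
  monotonicity of \<open>G\<close>, in the spirit of Ball, Carlen and Lieb:
  \<open>(p - 1) \<parallel>Z - X\<parallel>\<^sub>p\<^sup>2 \<le> \<langle>G Z - G X, Z - X\<rangle> ((\<psi> X + \<psi> Z) / 2)\<^bsup>(2 - p) / p\<^esup>\<close>.
  In the singular bases of \<open>X\<close> and \<open>Z\<close> the inner product is an exact sum over pairs of singular values,
  and scalar inequalities for powers bound it below by \<open>(p - 1) \<Sum>\<^sub>i\<^sub>j |P\<^sub>i\<^sub>j|\<^sup>2 ((x\<^sub>i + z\<^sub>j) / 2)\<^bsup>p - 2\<^esup>\<close>, where \<open>P\<close>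
  represents \<open>Z - X\<close> in these bases. As \<open>-1 \<le> p - 2 \<le> 0\<close>, this power is operator convex, and compressing
  to the singular vectors of \<open>P\<close> reduces the bound to the inequalities of Hoelder and Jensen.

  For \<open>d\<^sub>k\<close> with mean zero, integrating the monotonicity along \<open>m + t d\<^sub>k\<close> gives
  \<open>\<parallel>m\<parallel>\<^sup>2 + (p - 1) \<parallel>d\<parallel>\<^sup>2 \<le> \<parallel>m + d\<parallel>\<^sup>2\<close> in the normalised \<open>\<ell>\<^sub>p\<close> norm over \<open>k\<close>. Applied to
  \<open>\<Sum>\<^sub>j \<omega>\<^bsup>jk\<^esup> A\<^sub>j\<close> this splits off one frequency at a time, because multiplying by a character is
  isometric and shifts any chosen frequency to \<open>0\<close>; the frequency split off after \<open>i\<close> others gets the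
  coefficient \<open>(p - 1)\<^sup>i\<close>. As \<open>\<zeta>\<close> is the mean of \<open>(p - 1)\<^sup>i\<close> over \<open>1 \<le> i < r\<close>, averaging over the cyclic
  orders of the nonzero frequencies yields the theorem.
\<close>

section \<open>Powers of real numbers\<close>

text \<open>Weighted AM-GM with weights 1/p and 1 - 1/p, applied to x^p and y^p, puts x^p above its
  tangent at \<open>y\<close>. The zero cases are treated apart; there \<open>0 powr 0 = 0\<close>
  makes the slope 0 when p = 1 and y = 0.\<close>

lemma powr_tangent:
  fixes x y p :: real
  assumes "x \<ge> 0" "y \<ge> 0" "p \<ge> 1"
  shows "y powr p + p * y powr (p - 1) * (x - y) \<le> x powr p"
proof (cases "x = 0 \<or> y = 0")
  case True
  have "y powr (p - 1) * y = y powr p"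
    using assms by (cases "y = 0") (simp_all add: powr_mult_base mult.commute[of _ y])
  moreover have "y powr p \<le> p * y powr p"
    using assms by (simp add: mult_le_cancel_right1)
  ultimately show ?thesis
    using True assms by (auto simp: algebra_simps)
next
  case False
  with assms have pos: "x > 0" "y > 0" by auto
  have "(x powr p) powr (1/p) * (y powr p) powr (1 - 1/p) \<le> 1/p * x powr p + (1 - 1/p) * y powr p"
    using assms pos by (intro Youngs_inequality_0) auto
  moreover have "(x powr p) powr (1/p) * (y powr p) powr (1 - 1/p) = x * y powr (p - 1)"
    using assms pos by (simp add: powr_powr algebra_simps)
  ultimately have "p * (x * y powr (p - 1)) \<le> p * (1/p * x powr p + (1 - 1/p) * y powr p)"
    using assms by (intro mult_left_mono) auto
  then have "p * x * y powr (p - 1) \<le> x powr p + (p - 1) * y powr p"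
    using assms by (simp add: algebra_simps)
  moreover have "y powr (p - 1) * y = y powr p"
    using pos by (simp add: powr_mult_base mult.commute[of _ y])
  ultimately show ?thesis
    by (simp add: algebra_simps)
qed

text \<open>When the tangent inequalities at the weighted mean are summed with the weights, the
  linear terms cancel.\<close>

lemma powr_jensen_sum:
  fixes p :: real
  assumes "p \<ge> 1" "\<And>i. i \<in> S \<Longrightarrow> w i \<ge> 0" "\<And>i. i \<in> S \<Longrightarrow> a i \<ge> 0" "sum w S = 1"
  shows "(\<Sum>i\<in>S. w i * a i) powr p \<le> (\<Sum>i\<in>S. w i * a i powr p)"
proof -
  define y where "y = (\<Sum>i\<in>S. w i * a i)"
  have y: "y \<ge> 0" unfolding y_def using assms by (intro sum_nonneg) auto
  have "(\<Sum>i\<in>S. w i * (y powr p + p * y powr (p - 1) * (a i - y))) \<le> (\<Sum>i\<in>S. w i * a i powr p)"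
    using assms y by (intro sum_mono mult_left_mono powr_tangent) auto
  also have "(\<Sum>i\<in>S. w i * (y powr p + p * y powr (p - 1) * (a i - y)))
     = sum w S * y powr p + p * y powr (p - 1) * (\<Sum>i\<in>S. w i * a i) - p * y powr (p - 1) * y * sum w S"
    by (simp add: algebra_simps sum.distrib sum_subtractf sum_distrib_left sum_distrib_right)
  also have "\<dots> = y powr p"
    using assms by (simp add: y_def)
  finally show ?thesis by (simp add: y_def)
qed

text \<open>Hoelder's inequality for the exponent \<open>1 + g\<close>, arranged as a lower bound
  for \<open>sum f S\<close>. It carries a pointwise bound over to sums, first over singular values
  and later over the members of a family of matrices.\<close>

lemma reverse_Hoelder_sum:
  fixes f q Y :: "'a \<Rightarrow> real"
  assumes "finite S" "g \<ge> 0"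
    and nn: "\<And>k. k \<in> S \<Longrightarrow> f k \<ge> 0" "\<And>k. k \<in> S \<Longrightarrow> q k \<ge> 0" "\<And>k. k \<in> S \<Longrightarrow> Y k \<ge> 0"
    and le: "\<And>k. k \<in> S \<Longrightarrow> Y k powr (1 + g) \<le> f k * q k powr g"
  shows "(\<Sum>k\<in>S. Y k) powr (1 + g) \<le> (\<Sum>k\<in>S. f k) * (\<Sum>k\<in>S. q k) powr g"
proof (cases "\<forall>k\<in>S. Y k = 0")
  case True
  then show ?thesis using nn by (simp add: sum_nonneg)
next
  case False
  then obtain k0 where k0: "k0 \<in> S" "Y k0 > 0" using nn by force
  have fq: "f k > 0 \<and> q k > 0" if "k \<in> S" "Y k > 0" for k
  proof -
    have "0 < Y k powr (1 + g)" using that by simp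
    also have "\<dots> \<le> f k * q k powr g" using le that by auto
    finally have "f k \<noteq> 0" "q k \<noteq> 0" by auto
    then show ?thesis using nn that by (metis less_eq_real_def)
  qed
  define F where "F = sum f S"
  define Q where "Q = sum q S"
  define \<theta> where "\<theta> = 1 / (1 + g)"
  have \<theta>: "\<theta> > 0" "\<theta> \<le> 1" "\<theta> * (1 + g) = 1" using assms by (auto simp: \<theta>_def)
  have g\<theta>: "g * \<theta> = 1 - \<theta>" using \<theta> by (simp add: algebra_simps)
  have F: "F > 0" unfolding F_def using fq[OF k0] k0 nn assms by (intro sum_pos2[of S k0]) auto
  have Q: "Q > 0" unfolding Q_def using fq[OF k0] k0 nn assms by (intro sum_pos2[of S k0]) auto
  \<comment> \<open>Once \<open>f\<close> and \<open>q\<close> are scaled by their totals, Young's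
    inequality bounds each term linearly, and the linear bounds add up to
    \<open>F powr \<theta> * Q powr (1 - \<theta>)\<close>.\<close>
  have "Y k \<le> F powr \<theta> * Q powr (1 - \<theta>) * (\<theta> * (f k / F) + (1 - \<theta>) * (q k / Q))" if k: "k \<in> S" for k
  proof (cases "Y k = 0")
    case True
    then show ?thesis using nn k F Q \<theta> by simp
  next
    case False
    then have fqk: "f k > 0" "q k > 0" and Yk: "Y k > 0" using fq k nn by (auto simp: less_le)
    have "Y k = (Y k powr (1 + g)) powr \<theta>" using Yk \<theta> by (simp add: powr_powr mult.commute)
    also have "\<dots> \<le> (f k * q k powr g) powr \<theta>" using le k \<theta> by (intro powr_mono2) auto
    also have "\<dots> = f k powr \<theta> * q k powr (1 - \<theta>)" using fqk by (simp add: powr_mult powr_powr g\<theta>)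
    also have "\<dots> = F powr \<theta> * Q powr (1 - \<theta>) * ((f k / F) powr \<theta> * (q k / Q) powr (1 - \<theta>))"
      using fqk F Q by (simp add: powr_divide)
    also have "\<dots> \<le> F powr \<theta> * Q powr (1 - \<theta>) * (\<theta> * (f k / F) + (1 - \<theta>) * (q k / Q))"
      using fqk F Q \<theta> by (intro mult_left_mono Youngs_inequality_0) auto
    finally show ?thesis .
  qed
  then have "sum Y S \<le> (\<Sum>k\<in>S. F powr \<theta> * Q powr (1 - \<theta>) * (\<theta> * (f k / F) + (1 - \<theta>) * (q k / Q)))"
    by (rule sum_mono)
  also have "\<dots> = F powr \<theta> * Q powr (1 - \<theta>) * (\<theta> * (F / F) + (1 - \<theta>) * (Q / Q))"
    unfolding F_def Q_def
    by (simp add: sum_distrib_left[symmetric] sum.distrib sum_divide_distrib[symmetric])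
  also have "\<dots> = F powr \<theta> * Q powr (1 - \<theta>)" using F Q by simp
  finally have "sum Y S powr (1 + g) \<le> (F powr \<theta> * Q powr (1 - \<theta>)) powr (1 + g)"
    using assms by (intro powr_mono2 sum_nonneg) auto
  also have "\<dots> = F * Q powr g"
  proof -
    have "(1 - \<theta>) * (1 + g) = g" using \<theta> by (simp add: algebra_simps)
    then show ?thesis using F Q \<theta> by (simp add: powr_mult powr_powr)
  qed
  finally show ?thesis unfolding F_def Q_def .
qed

section \<open>Midpoint estimates for powers\<close>

text \<open>The exponential lies above its tangent: 2^(a-1) >= 1 + (a-1) ln 2 >= a, because ln 2 < 1
  and a - 1 <= 0.\<close>

lemma two_powr_ge_double:
  fixes a :: real
  assumes "0 \<le> a" "a \<le> 1"
  shows "2 * a \<le> 2 powr a"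
proof -
  have "1 + (a - 1) \<le> 1 + (a - 1) * ln 2"
    using assms ln_2_less_1 mult_left_mono_neg[of "ln 2" 1 "a - 1"] by simp
  also have "\<dots> \<le> exp ((a - 1) * ln 2)" by (rule exp_ge_add_one_self)
  also have "\<dots> = 2 powr a / 2" by (simp add: powr_def algebra_simps exp_diff)
  finally show ?thesis by simp
qed

lemma powr_midpoint_neg:
  fixes u v b :: real
  assumes "u > 0" "v > 0" "b \<ge> 0"
  shows "2 * ((u + v) / 2) powr (- b) \<le> u powr (- b) + v powr (- b)"
proof -
  have "convex_on {0<..} (\<lambda>x::real. x powr (- b))"
  proof (intro f''_ge0_imp_convex)
    show "((\<lambda>x. x powr (-b)) has_real_derivative (-b) * x powr (-b - 1)) (at x)" if "x \<in> {0<..}" for x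
      using that by (auto intro!: derivative_eq_intros)
    show "((\<lambda>x. (-b) * x powr (-b - 1)) has_real_derivative (-b) * ((-b - 1) * x powr (-b - 1 - 1))) (at x)"
      if "x \<in> {0<..}" for x
      using that by (auto intro!: derivative_eq_intros)
    show "0 \<le> (-b) * ((-b - 1) * x powr (-b - 1 - 1))" for x
      using assms by (intro mult_nonpos_nonpos mult_nonpos_nonneg) auto
  qed auto
  from convex_onD[OF this, of "1/2" u v] assms show ?thesis
    by (simp add: add_divide_distrib)
qed

text \<open>With midpoint \<open>m\<close> and half difference \<open>h\<close>, the claim is that
  (m+h)^a - (m-h)^a is at least 2 a h m^(a-1). Both sides vanish at h = 0, and convexity of u^(a-1)
  compares their derivatives.\<close>

lemma powr_diff_midpoint:
  fixes z x a :: real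
  assumes "z \<ge> 0" "x \<ge> 0" "0 < a" "a \<le> 1"
  shows "a * (z - x)\<^sup>2 * ((z + x) / 2) powr (a - 1) \<le> (z - x) * (z powr a - x powr a)"
  using assms(1,2)
proof (induction x z rule: linorder_wlog)
  case (sym a b)
  then show ?case by (simp add: algebra_simps power2_commute[of a b])
next
  case (le x z)
  define m where "m = (z + x) / 2"
  define h where "h = (z - x) / 2"
  have mh: "z = m + h" "x = m - h" by (auto simp: m_def h_def field_simps)
  have h: "h \<ge> 0" "h \<le> m" using le by (auto simp: m_def h_def)
  define G where "G = (\<lambda>u. (m + u) powr a - (m - u) powr a - 2 * a * u * m powr (a - 1))"
  have "G 0 \<le> G h"
  \<comment> \<open>If x = 0 then h = m, and (m-u)^a may fail to be differentiable at the endpoint u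
    = h; continuity on the closed interval covers that case.\<close>
  proof (rule DERIV_nonneg_imp_increasing_open[OF h(1)])
    fix u assume u: "0 < u" "u < h"
    have "(G has_real_derivative (a * (m + u) powr (a - 1) + a * (m - u) powr (a - 1) - 2 * a * m powr (a - 1))) (at u)"
      unfolding G_def using u h by (auto intro!: derivative_eq_intros)
    moreover have "2 * ((m + u + (m - u)) / 2) powr (- (1 - a)) \<le> (m + u) powr (- (1 - a)) + (m - u) powr (- (1 - a))"
      using u h assms by (intro powr_midpoint_neg) auto
    then have "a * (2 * m powr (a - 1)) \<le> a * ((m + u) powr (a - 1) + (m - u) powr (a - 1))"
      using assms by (intro mult_left_mono) auto
    then have "0 \<le> a * (m + u) powr (a - 1) + a * (m - u) powr (a - 1) - 2 * a * m powr (a - 1)"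
      by (simp add: algebra_simps)
    ultimately show "\<exists>y. DERIV G u :> y \<and> 0 \<le> y" by blast
  next
    show "continuous_on {0..h} G"
      unfolding G_def using h assms by (intro continuous_intros continuous_on_powr') auto
  qed
  then have "2 * a * h * m powr (a - 1) \<le> z powr a - x powr a"
    by (simp add: G_def mh)
  then have "(2 * h) * (2 * a * h * m powr (a - 1)) \<le> (2 * h) * (z powr a - x powr a)"
    using h by (intro mult_left_mono) auto
  moreover have "z - x = 2 * h" by (simp add: h_def)
  ultimately show ?case
    unfolding m_def[symmetric] by (simp add: power2_eq_square mult_ac)
qed

text \<open>This combines the subadditivity of x^a with the bound 2 a <= 2^a on the constant that
  remains.\<close>

lemma powr_sum_midpoint:
  fixes z x a :: real
  assumes "z \<ge> 0" "x \<ge> 0" "0 < a" "a \<le> 1"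
  shows "a * (z + x)\<^sup>2 * ((z + x) / 2) powr (a - 1) \<le> (z + x) * (z powr a + x powr a)"
proof (cases "z + x = 0")
  case False
  then have pos: "z + x > 0" using assms by auto
  \<comment> \<open>As a - 1 <= 0, y^(a-1) is at least (z+x)^(a-1). The instances
    \<open>y = z\<close> and \<open>y = x\<close> add up to subadditivity.\<close>
  have ge: "y powr a * (z + x) \<ge> y * (z + x) powr a" if y: "0 \<le> y" "y \<le> z + x" for y
  proof (cases "y = 0")
    case False
    have "(z + x) powr (a - 1) \<le> y powr (a - 1)"
      using y False assms by (intro powr_mono2') auto
    then have "(y * (z + x)) * (z + x) powr (a - 1) \<le> (y * (z + x)) * y powr (a - 1)"
      using y by (intro mult_left_mono) auto
    moreover have "(z + x) * (z + x) powr (a - 1) = (z + x) powr a" "y * y powr (a - 1) = y powr a"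
      using y False pos by (simp_all add: powr_mult_base)
    ultimately show ?thesis by (metis mult.commute mult.left_commute)
  qed simp
  have "(z + x) powr a * (z + x) \<le> (z powr a + x powr a) * (z + x)"
    using ge[of z] ge[of x] assms by (simp add: algebra_simps)
  then have le: "(z + x) powr a \<le> z powr a + x powr a" using pos by simp
  have "a * (z + x)\<^sup>2 * ((z + x) / 2) powr (a - 1)
      = (z + x) * (2 * a * (((z + x) / 2) * ((z + x) / 2) powr (a - 1)))"
    by (simp add: power2_eq_square)
  also have "((z + x) / 2) * ((z + x) / 2) powr (a - 1) = (z + x) powr a / 2 powr a"
    using pos by (simp add: powr_mult_base powr_divide)
  also have "2 * a * ((z + x) powr a / 2 powr a) \<le> 2 powr a * ((z + x) powr a / 2 powr a)"
    using assms by (intro mult_right_mono two_powr_ge_double) auto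
  finally have "a * (z + x)\<^sup>2 * ((z + x) / 2) powr (a - 1) \<le> (z + x) * (z + x) powr a"
    using pos by simp
  also have "\<dots> \<le> (z + x) * (z powr a + x powr a)" using le pos by (intro mult_left_mono) auto
  finally show ?thesis .
qed auto

section \<open>Operator convexity of negative powers\<close>

text \<open>Negative powers are mixtures of resolvents. Substituting x t for t extracts x^(-b), and
  \<open>K\<close> is the integral at x = 1. It is finite because the integrand is dominated by
  t^(-b) up to 1 and by t^(-b-1) beyond. Being finite and positive, \<open>K\<close> can later be
  cancelled.\<close>

lemma nn_integral_powr_resolvent:
  fixes b :: real
  assumes b: "0 < b" "b < 1"
  obtains K where "0 < K" "K < \<infinity>"
    "\<And>x. x > 0 \<Longrightarrow> (\<integral>\<^sup>+t. ennreal (t powr (- b) / (t + x)) * indicator {0<..} t \<partial>lborel) = K * ennreal (x powr (- b))"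
proof -
  define K where "K = (\<integral>\<^sup>+t. ennreal (t powr (- b) / (t + 1)) * indicator {0<..} t \<partial>lborel)"
  have scale: "(\<integral>\<^sup>+t. ennreal (t powr (- b) / (t + x)) * indicator {0<..} t \<partial>lborel) = K * ennreal (x powr (- b))"
    if x: "x > 0" for x
  proof -
    have "(\<integral>\<^sup>+t. ennreal (t powr (- b) / (t + x)) * indicator {0<..} t \<partial>lborel)
        = ennreal x * (\<integral>\<^sup>+t. ennreal ((x * t) powr (- b) / (x * t + x)) * indicator {0<..} (x * t) \<partial>lborel)"
      using x by (subst nn_integral_real_affine[where c = x and t = 0]) auto
    also have "(\<integral>\<^sup>+t. ennreal ((x * t) powr (- b) / (x * t + x)) * indicator {0<..} (x * t) \<partial>lborel)
        = (\<integral>\<^sup>+t. ennreal (x powr (- b) / x) * (ennreal (t powr (- b) / (t + 1)) * indicator {0<..} t) \<partial>lborel)"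
    proof (intro nn_integral_cong)
      fix t :: real
      have "(x * t) powr (- b) / (x * t + x) = x powr (- b) / x * (t powr (- b) / (t + 1))" if "t > 0"
      proof -
        have "x * t + x = x * (t + 1)" by (simp add: algebra_simps)
        then show ?thesis using x that by (simp add: powr_mult)
      qed
      then show "ennreal ((x * t) powr (- b) / (x * t + x)) * indicator {0<..} (x * t)
        = ennreal (x powr (- b) / x) * (ennreal (t powr (- b) / (t + 1)) * indicator {0<..} t)"
        using x by (auto simp: indicator_def zero_less_mult_iff ennreal_mult[symmetric])
    qed
    also have "\<dots> = ennreal (x powr (- b) / x) * K"
      unfolding K_def by (rule nn_integral_cmult) auto
    also have "ennreal x * \<dots> = K * ennreal (x powr (- b))"
    proof -
      have "ennreal x * (ennreal (x powr (- b) / x) * K) = ennreal (x * (x powr (- b) / x)) * K"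
        using x by (subst ennreal_mult) (auto simp: mult.assoc)
      then show ?thesis using x by (simp add: mult.commute)
    qed
    finally show ?thesis .
  qed
  have "K \<le> (\<integral>\<^sup>+t. ennreal (t powr (- b)) * indicator {0..1} t + ennreal (t powr (- b - 1)) * indicator {1..} t \<partial>lborel)"
    unfolding K_def
  proof (intro nn_integral_mono)
    fix t :: real
    have 1: "t powr (- b) / (t + 1) \<le> t powr (- b)" if "t > 0"
      using that by (simp add: divide_le_eq mult_le_cancel_left1)
    have 2: "t powr (- b) / (t + 1) \<le> t powr (- b - 1)" if "t > 0"
      using that by (simp add: powr_diff frac_le)
    show "ennreal (t powr (- b) / (t + 1)) * indicator {0<..} t
      \<le> ennreal (t powr (- b)) * indicator {0..1} t + ennreal (t powr (- b - 1)) * indicator {1..} t"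
    proof (cases "t \<le> 1")
      case True
      have "ennreal (t powr (- b) / (t + 1)) * indicator {0<..} t \<le> ennreal (t powr (- b)) * indicator {0..1} t"
        using 1 True by (auto simp: indicator_def intro!: ennreal_leI)
      then show ?thesis by (rule add_increasing2[rotated]) simp
    next
      case False
      then show ?thesis using 2 by (auto simp: indicator_def intro: ennreal_leI)
    qed
  qed
  also have "\<dots> = (\<integral>\<^sup>+t. ennreal (t powr (- b)) * indicator {0..1} t \<partial>lborel)
      + (\<integral>\<^sup>+t. ennreal (t powr (- b - 1)) * indicator {1..} t \<partial>lborel)"
    by (rule nn_integral_add) auto
  finally have K_le: "K \<le> (\<integral>\<^sup>+t. ennreal (t powr (- b)) * indicator {0..1} t \<partial>lborel)
      + (\<integral>\<^sup>+t. ennreal (t powr (- b - 1)) * indicator {1..} t \<partial>lborel)" .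
  have "(\<integral>\<^sup>+t. ennreal (t powr (- b)) * indicator {0..1} t \<partial>lborel) < \<infinity>"
  proof -
    have "((\<lambda>t. t powr (- b)) has_integral 1 powr (- b + 1) / (- b + 1)) {0..1::real}"
      using b by (intro has_integral_powr_from_0) auto
    then show ?thesis
      by (subst nn_integral_has_integral_lebesgue') auto
  qed
  moreover have "(\<integral>\<^sup>+t. ennreal (t powr (- b - 1)) * indicator {1..} t \<partial>lborel) < \<infinity>"
  proof -
    have "((\<lambda>t. t powr (- b - 1)) has_integral - (1 powr (- b - 1 + 1)) / (- b - 1 + 1)) {1::real..}"
      using b by (intro has_integral_powr_to_inf) auto
    then show ?thesis
      by (subst nn_integral_has_integral_lebesgue') auto
  qed
  ultimately have fin: "K < \<infinity>" using K_le by (simp add: order_le_less_trans)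
  have "0 < ennreal (1 / 4)" by simp
  also have "ennreal (1 / 4) = ennreal (1 / 4) * emeasure lborel {0..(1::real)}" by simp
  also have "\<dots> = (\<integral>\<^sup>+t. ennreal (1 / 4) * indicator {0..1::real} t \<partial>lborel)"
    by (rule nn_integral_cmult_indicator[symmetric]) auto
  also have "\<dots> \<le> K"
    unfolding K_def
  \<comment> \<open>At t = 0 only the indicator on the left is 1, so the comparison holds almost
    everywhere but not at that point.\<close>
  proof (rule nn_integral_mono_AE)
    have "1 / 4 \<le> t powr (- b) / (t + 1)" if "0 < t" "t \<le> 1" for t :: real
    proof -
      have "1 powr (- b) \<le> t powr (- b)" using that b by (intro powr_mono2') auto
      then have "1 \<le> t powr (- b)" by simp
      then show ?thesis using that by (simp add: le_divide_eq)
    qed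
    moreover have "AE t in lborel. t \<noteq> (0::real)" by (rule AE_lborel_singleton)
    ultimately show "AE t in lborel. ennreal (1 / 4) * indicator {0..1::real} t
        \<le> ennreal (t powr (- b) / (t + 1)) * indicator {0<..} t"
      by (auto simp: indicator_def intro!: ennreal_leI elim!: AE_mp)
  qed
  finally have "0 < K" .
  with fin scale show thesis using that by blast
qed

lemma nn_integral_powr_resolvent_sum:
  fixes u x :: "'a \<Rightarrow> real"
  assumes int: "\<And>x::real. x > 0 \<Longrightarrow> (\<integral>\<^sup>+t. ennreal (t powr (- b) / (t + x)) * indicator {0<..} t \<partial>lborel) = K * ennreal (x powr (- b))"
    and A: "finite A" "\<And>i. i \<in> A \<Longrightarrow> 0 \<le> u i" "\<And>i. i \<in> A \<Longrightarrow> 0 < x i"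
  shows "(\<integral>\<^sup>+t. ennreal (t powr (- b) * (\<Sum>i\<in>A. u i / (t + x i))) * indicator {0<..} t \<partial>lborel)
      = K * ennreal (\<Sum>i\<in>A. u i * x i powr (- b))"
proof -
  have "(\<integral>\<^sup>+t. ennreal (t powr (- b) * (\<Sum>i\<in>A. u i / (t + x i))) * indicator {0<..} t \<partial>lborel)
     = (\<integral>\<^sup>+t. (\<Sum>i\<in>A. ennreal (u i) * (ennreal (t powr (- b) / (t + x i)) * indicator {0<..} t)) \<partial>lborel)"
  proof (intro nn_integral_cong)
    fix t :: real
    show "ennreal (t powr (- b) * (\<Sum>i\<in>A. u i / (t + x i))) * indicator {0<..} t
      = (\<Sum>i\<in>A. ennreal (u i) * (ennreal (t powr (- b) / (t + x i)) * indicator {0<..} t))"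
    proof (cases "t > 0")
      case True
      have "ennreal (t powr (- b) * (\<Sum>i\<in>A. u i / (t + x i))) = ennreal (\<Sum>i\<in>A. u i * (t powr (- b) / (t + x i)))"
        by (simp add: sum_distrib_left mult_ac)
      also have "\<dots> = (\<Sum>i\<in>A. ennreal (u i * (t powr (- b) / (t + x i))))"
        using A True by (intro sum_ennreal[symmetric]) (auto simp: less_imp_le intro!: mult_nonneg_nonneg divide_nonneg_pos add_pos_pos)
      also have "\<dots> = (\<Sum>i\<in>A. ennreal (u i) * ennreal (t powr (- b) / (t + x i)))"
        using A True by (intro sum.cong ennreal_mult) (auto simp: less_imp_le intro!: divide_nonneg_pos add_pos_pos)
      finally show ?thesis using True by simp
    qed simp
  qed
  also have "\<dots> = (\<Sum>i\<in>A. ennreal (u i) * (K * ennreal (x i powr (- b))))"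
    using A by (simp add: nn_integral_sum nn_integral_cmult int)
  also have "\<dots> = K * (\<Sum>i\<in>A. ennreal (u i * x i powr (- b)))"
    using A by (simp add: sum_distrib_left ennreal_mult mult_ac)
  also have "\<dots> = K * ennreal (\<Sum>i\<in>A. u i * x i powr (- b))"
    using A by (subst sum_ennreal) auto
  finally show ?thesis .
qed

text \<open>For 0 < b < 1 the resolvent inequality is integrated against t^(-b) and \<open>K\<close>
  is cancelled. The integral diverges for b = 0 and b = 1; these cases are the equality of the total
  masses and the resolvent inequality at t = 0.\<close>

lemma resolvent_dominated_powr:
  fixes b :: real and s w :: "'a \<Rightarrow> real" and d v :: "'b \<Rightarrow> real"
  assumes b: "0 \<le> b" "b \<le> 1"
    and fin: "finite I" "finite J"
    and w: "\<And>i. i \<in> I \<Longrightarrow> 0 \<le> w i" "\<And>i. i \<in> I \<Longrightarrow> 0 < s i"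
    and v: "\<And>j. j \<in> J \<Longrightarrow> 0 \<le> v j" "\<And>j. j \<in> J \<Longrightarrow> 0 < d j"
    and eq: "sum v J = sum w I"
    and le: "\<And>t. t \<ge> 0 \<Longrightarrow> (\<Sum>j\<in>J. v j / (t + d j)) \<le> (\<Sum>i\<in>I. w i / (t + s i))"
  shows "(\<Sum>j\<in>J. v j * d j powr (- b)) \<le> (\<Sum>i\<in>I. w i * s i powr (- b))"
proof (cases "b = 0 \<or> b = 1")
  case True
  have nz: "s i \<noteq> 0" if "i \<in> I" for i using w(2)[OF that] by simp
  have nz': "d i \<noteq> 0" if "i \<in> J" for i using v(2)[OF that] by simp
  from True show ?thesis
  proof
    assume "b = 0" then show ?thesis using eq w(2) v(2) nz nz' by simp
  next
    assume "b = 1" then show ?thesis using le[of 0] w(2) v(2) by (simp add: powr_minus_divide less_imp_le)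
  qed
next
  case False
  with b have b': "0 < b" "b < 1" by auto
  obtain K where K: "0 < K" "K < \<infinity>"
    and int: "\<And>x. x > 0 \<Longrightarrow> (\<integral>\<^sup>+t. ennreal (t powr (- b) / (t + x)) * indicator {0<..} t \<partial>lborel) = K * ennreal (x powr (- b))"
    using nn_integral_powr_resolvent[OF b'] by blast
  have "(\<integral>\<^sup>+t. ennreal (t powr (- b) * (\<Sum>j\<in>J. v j / (t + d j))) * indicator {0<..} t \<partial>lborel)
     \<le> (\<integral>\<^sup>+t. ennreal (t powr (- b) * (\<Sum>i\<in>I. w i / (t + s i))) * indicator {0<..} t \<partial>lborel)"
  proof (intro nn_integral_mono)
    fix t :: real
    show "ennreal (t powr (- b) * (\<Sum>j\<in>J. v j / (t + d j))) * indicator {0<..} t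
       \<le> ennreal (t powr (- b) * (\<Sum>i\<in>I. w i / (t + s i))) * indicator {0<..} t"
      using le[of t] by (auto simp: indicator_def intro!: ennreal_leI mult_left_mono)
  qed
  then have "K * ennreal (\<Sum>j\<in>J. v j * d j powr (- b)) \<le> K * ennreal (\<Sum>i\<in>I. w i * s i powr (- b))"
    using nn_integral_powr_resolvent_sum[of b K J v d] nn_integral_powr_resolvent_sum[of b K I w s] int fin v w
    by simp
  then have "ennreal (\<Sum>j\<in>J. v j * d j powr (- b)) \<le> ennreal (\<Sum>i\<in>I. w i * s i powr (- b))"
    using K by (simp add: ennreal_mult_le_mult_iff)
  moreover have "0 \<le> (\<Sum>i\<in>I. w i * s i powr (- b))"
    using w by (intro sum_nonneg) auto
  ultimately show ?thesis by simp
qed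

section \<open>Singular value decomposition\<close>

lemma mult_cnj_self: "z * cnj z = (complex_of_real (cmod z))\<^sup>2"
  using complex_norm_square[of z] by simp

lemma cnj_mult_self: "cnj z * z = (complex_of_real (cmod z))\<^sup>2"
  using mult_cnj_self[of z] by (simp add: mult.commute)

lemma mat_adjoint_carrier [simp]: "A \<in> carrier_mat n m \<Longrightarrow> mat_adjoint A \<in> carrier_mat m n"
  unfolding mat_adjoint_def by (auto simp: mat_of_rows_def)

lemma mat_adjoint_dim [simp]: "dim_row (mat_adjoint A) = dim_col A" "dim_col (mat_adjoint A) = dim_row A"
  unfolding mat_adjoint_def by (auto simp: mat_of_rows_def)

lemma mat_adjoint_index [simp]:
  fixes A :: "complex mat"
  assumes "i < dim_col A" "j < dim_row A"
  shows "mat_adjoint A $$ (i, j) = cnj (A $$ (j, i))"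
  using assms unfolding mat_adjoint_def by (simp add: mat_of_rows_def)

lemma index_mult_mat_sum:
  fixes A B :: "complex mat"
  assumes "A \<in> carrier_mat n m" "B \<in> carrier_mat m l" "i < n" "j < l"
  shows "(A * B) $$ (i, j) = (\<Sum>k<m. A $$ (i, k) * B $$ (k, j))"
  using assms by (auto simp: scalar_prod_def atLeast0LessThan intro!: sum.cong)

lemma mat_adjoint_adjoint [simp]:
  fixes A :: "complex mat"
  shows "mat_adjoint (mat_adjoint A) = A"
  by (rule eq_matI) auto

lemma mat_adjoint_mult:
  fixes A B :: "complex mat"
  assumes "A \<in> carrier_mat n m" "B \<in> carrier_mat m l"
  shows "mat_adjoint (A * B) = mat_adjoint B * mat_adjoint A"
proof (rule eq_matI)
  fix i j assume "i < dim_row (mat_adjoint B * mat_adjoint A)" "j < dim_col (mat_adjoint B * mat_adjoint A)"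
  then have ij: "i < l" "j < n" using assms by auto
  then have "mat_adjoint (A * B) $$ (i, j) = (\<Sum>k<m. cnj (A $$ (j, k)) * cnj (B $$ (k, i)))"
    using assms by (simp add: index_mult_mat_sum[OF assms] del: index_mult_mat(1))
  also have "\<dots> = (mat_adjoint B * mat_adjoint A) $$ (i, j)"
    using assms ij
    by (simp add: index_mult_mat_sum[of _ l m _ n] mult.commute del: index_mult_mat(1))
  finally show "mat_adjoint (A * B) $$ (i, j) = (mat_adjoint B * mat_adjoint A) $$ (i, j)" .
qed (use assms in auto)

definition unitary_mat :: "nat \<Rightarrow> complex mat \<Rightarrow> bool" where
  "unitary_mat n U \<longleftrightarrow> U \<in> carrier_mat n n \<and> mat_adjoint U * U = 1\<^sub>m n"

lemma unitary_matD:
  assumes "unitary_mat n U"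
  shows "U \<in> carrier_mat n n" "mat_adjoint U * U = 1\<^sub>m n" "U * mat_adjoint U = 1\<^sub>m n"
  using assms mat_mult_left_right_inverse[of "mat_adjoint U" n U] by (auto simp: unitary_mat_def)

lemma unitary_mat_adjoint: "unitary_mat n U \<Longrightarrow> unitary_mat n (mat_adjoint U)"
  unfolding unitary_mat_def[of n "mat_adjoint U"] mat_adjoint_adjoint
  by (intro conjI mat_adjoint_carrier unitary_matD)

lemma unitary_mat_mult:
  assumes "unitary_mat n U" "unitary_mat n V"
  shows "unitary_mat n (U * V)"
proof -
  note U = unitary_matD[OF assms(1)] and V = unitary_matD[OF assms(2)]
  have "mat_adjoint (U * V) * (U * V) = mat_adjoint V * (mat_adjoint U * U) * V"
    unfolding mat_adjoint_mult[OF U(1) V(1)]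
    using assoc_mult_mat[of "mat_adjoint V" n n "mat_adjoint U" n "U * V" n]
      assoc_mult_mat[of "mat_adjoint U" n n U n V n] assoc_mult_mat[of "mat_adjoint V" n n "mat_adjoint U * U" n V n]
      U(1) V(1) by (simp add: mult_carrier_mat[of _ n n])
  then show ?thesis using U V by (auto simp: unitary_mat_def)
qed

lemma unitary_mat_cols:
  assumes "unitary_mat n U" "i < n" "j < n"
  shows "(\<Sum>k<n. cnj (U $$ (k, i)) * U $$ (k, j)) = (if i = j then 1 else 0)"
proof -
  note U = unitary_matD[OF assms(1)]
  have "(\<Sum>k<n. cnj (U $$ (k, i)) * U $$ (k, j)) = (mat_adjoint U * U) $$ (i, j)"
    using U(1) assms by (subst index_mult_mat_sum[of _ n n _ n]) auto
  then show ?thesis using U(2) assms by simp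
qed

lemma unitary_mat_rows:
  assumes "unitary_mat n U" "i < n" "j < n"
  shows "(\<Sum>k<n. U $$ (i, k) * cnj (U $$ (j, k))) = (if i = j then 1 else 0)"
proof -
  note U = unitary_matD[OF assms(1)]
  have "(\<Sum>k<n. U $$ (i, k) * cnj (U $$ (j, k))) = (U * mat_adjoint U) $$ (i, j)"
    using U(1) assms by (subst index_mult_mat_sum[of _ n n _ n]) auto
  then show ?thesis using U(3) assms by simp
qed

lemma unitary_mat_sum_cols:
  assumes "unitary_mat n U" "i < n"
  shows "(\<Sum>k<n. (cmod (U $$ (k, i)))\<^sup>2) = 1"
proof -
  have "complex_of_real (\<Sum>k<n. (cmod (U $$ (k, i)))\<^sup>2) = (\<Sum>k<n. cnj (U $$ (k, i)) * U $$ (k, i))"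
    by (simp add: cnj_mult_self)
  then show ?thesis using unitary_mat_cols[OF assms(1,2,2)] by (metis of_real_eq_1_iff)
qed

lemma unitary_mat_sum_rows:
  assumes "unitary_mat n U" "i < n"
  shows "(\<Sum>k<n. (cmod (U $$ (i, k)))\<^sup>2) = 1"
proof -
  have "complex_of_real (\<Sum>k<n. (cmod (U $$ (i, k)))\<^sup>2) = (\<Sum>k<n. U $$ (i, k) * cnj (U $$ (i, k)))"
    by (simp add: mult_cnj_self)
  then show ?thesis using unitary_mat_rows[OF assms(1,2,2)] by (metis of_real_eq_1_iff)
qed

section \<open>Unit vectors and orthonormal bases\<close>

lemma normalize_vec:
  fixes w :: "complex vec"
  assumes w: "w \<in> carrier_vec n" "w \<noteq> 0\<^sub>v n"
  obtains u c where "(\<Sum>i<n. (cmod (u i))\<^sup>2) = 1" "\<And>i. u i = c * w $ i"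
proof -
  obtain k where k: "k < n" "w $ k \<noteq> 0" using w by (metis eq_vecI carrier_vecD index_zero_vec)
  define s where "s = (\<Sum>i<n. (cmod (w $ i))\<^sup>2)"
  have s: "s > 0" unfolding s_def using k by (intro sum_pos2[of _ k]) auto
  define u where "u i = complex_of_real (1 / sqrt s) * w $ i" for i
  have "(\<Sum>i<n. (cmod (u i))\<^sup>2) = (\<Sum>i<n. (cmod (w $ i))\<^sup>2 / s)"
    using s by (simp add: u_def norm_mult norm_divide power_divide)
  also have "\<dots> = 1" using s by (simp add: s_def[symmetric] sum_divide_distrib[symmetric])
  finally show thesis using that[of u] u_def by blast
qed

text \<open>A matrix with a zero row is singular. When the other rows are the conjugates of fewer
  than \<open>n\<close> vectors, the kernel vector is orthogonal to all of them.\<close>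

lemma unit_kernel_vector:
  fixes N :: "complex mat"
  assumes N: "N \<in> carrier_mat n n" and r: "r < n" "\<And>j. j < n \<Longrightarrow> N $$ (r, j) = 0"
  obtains u where "(\<Sum>i<n. (cmod (u i))\<^sup>2) = 1" "\<And>i. i < n \<Longrightarrow> (\<Sum>j<n. N $$ (i, j) * u j) = 0"
proof -
  have "transpose_mat N *\<^sub>v unit_vec n r = 0\<^sub>v n"
    using N r by (intro eq_vecI) (auto simp: scalar_prod_right_unit)
  moreover have "unit_vec n r \<noteq> (0\<^sub>v n :: complex vec)" using r
    by (metis index_unit_vec(2) index_zero_vec(1) zero_neq_one)
  ultimately have "det (transpose_mat N) = 0"
    using N det_0_iff_vec_prod_zero_field[of "transpose_mat N" n] by (metis transpose_carrier_mat unit_vec_carrier)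
  then have "det N = 0" using N by (simp add: det_transpose)
  then obtain w where w: "w \<in> carrier_vec n" "w \<noteq> 0\<^sub>v n" "N *\<^sub>v w = 0\<^sub>v n"
    using det_0_iff_vec_prod_zero_field[OF N] by auto
  obtain u c where u: "(\<Sum>i<n. (cmod (u i))\<^sup>2) = 1" "\<And>i. u i = c * w $ i"
    using normalize_vec[OF w(1,2)] by blast
  have "(\<Sum>j<n. N $$ (i, j) * u j) = 0" if i: "i < n" for i
  proof -
    have "(\<Sum>j<n. N $$ (i, j) * u j) = c * (N *\<^sub>v w) $ i"
      using N w(1) i by (auto simp: u scalar_prod_def sum_distrib_left atLeast0LessThan intro!: sum.cong)
    then show ?thesis using w i by simp
  qed
  then show thesis using that u by blast
qed

text \<open>An orthonormal system starting with \<open>v\<close> is enlarged one vector at a time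
  until it has \<open>n\<close> members; these become the columns of \<open>W\<close>.\<close>

lemma unitary_extension:
  fixes v :: "nat \<Rightarrow> complex"
  assumes n: "n > 0" and v: "(\<Sum>i<n. (cmod (v i))\<^sup>2) = 1"
  obtains W where "unitary_mat n W" "\<And>i. i < n \<Longrightarrow> W $$ (i, 0) = v i"
proof -
  have "\<exists>f. f 0 = v \<and> (\<forall>i<k. \<forall>j<k. (\<Sum>l<n. cnj (f i l) * f j l) = (if i = j then 1 else 0))"
    if "1 \<le> k" "k \<le> n" for k
    using that
  proof (induction k rule: nat_induct_at_least)
    case base
    have "(\<Sum>l<n. cnj (v l) * v l) = complex_of_real (\<Sum>i<n. (cmod (v i))\<^sup>2)"
      by (simp add: cnj_mult_self)
    then show ?case using v by (intro exI[of _ "\<lambda>_. v"]) auto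
  next
    case (Suc k)
    then obtain f where f: "f 0 = v" "\<And>i j. i < k \<Longrightarrow> j < k \<Longrightarrow> (\<Sum>l<n. cnj (f i l) * f j l) = (if i = j then 1 else 0)"
      by auto
    \<comment> \<open>The first \<open>k\<close> rows are the conjugates of the vectors already
      found; row \<open>k\<close> is a zero row, which exists because \<open>k < n\<close>.\<close>
    define N where "N = mat n n (\<lambda>(i, l). if i < k then cnj (f i l) else 0)"
    obtain u where u: "(\<Sum>i<n. (cmod (u i))\<^sup>2) = 1" "\<And>i. i < n \<Longrightarrow> (\<Sum>j<n. N $$ (i, j) * u j) = 0"
      using unit_kernel_vector[of N n k] Suc.prems by (auto simp: N_def)
    have uu: "(\<Sum>l<n. cnj (u l) * u l) = 1"
    proof -
      have "(\<Sum>l<n. cnj (u l) * u l) = complex_of_real (\<Sum>i<n. (cmod (u i))\<^sup>2)"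
        by (simp add: cnj_mult_self)
      then show ?thesis using u by simp
    qed
    have fu: "(\<Sum>l<n. cnj (f i l) * u l) = 0" if "i < k" for i
      using u(2)[of i] that Suc.prems by (simp add: N_def)
    have uf: "(\<Sum>l<n. cnj (u l) * f i l) = 0" if "i < k" for i
    proof -
      have "(\<Sum>l<n. cnj (u l) * f i l) = cnj (\<Sum>l<n. cnj (f i l) * u l)" by (simp add: mult.commute)
      then show ?thesis using fu[OF that] by simp
    qed
    have k0: "k \<noteq> 0" using Suc.hyps by simp
    define f' where "f' = f(k := u)"
    have f': "f' i = (if i = k then u else f i)" for i by (simp add: f'_def)
    have "f' 0 = v" using k0 f(1) by (simp add: f')
    moreover have "(\<Sum>l<n. cnj (f' i l) * f' j l) = (if i = j then 1 else 0)"
      if "i < Suc k" "j < Suc k" for i j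
    proof -
      consider "i = k" "j = k" | "i = k" "j < k" | "i < k" "j = k" | "i < k" "j < k"
        using \<open>i < Suc k\<close> \<open>j < Suc k\<close> by linarith
      then show ?thesis by cases (simp_all add: f' uu uf fu f(2))
    qed
    ultimately show ?case by blast
  qed
  then obtain f where f: "f 0 = v"
      "\<And>i j. i < n \<Longrightarrow> j < n \<Longrightarrow> (\<Sum>l<n. cnj (f i l) * f j l) = (if i = j then 1 else 0)"
    using n by (metis One_nat_def Suc_leI order_refl)
  define W where "W = mat n n (\<lambda>(l, i). f i l)"
  have W: "W \<in> carrier_mat n n" by (simp add: W_def)
  have "mat_adjoint W * W = 1\<^sub>m n"
  proof (rule eq_matI)
    fix i j assume "i < dim_row (1\<^sub>m n :: complex mat)" "j < dim_col (1\<^sub>m n :: complex mat)"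
    then have ij: "i < n" "j < n" by auto
    then have "(mat_adjoint W * W) $$ (i, j) = (\<Sum>k<n. mat_adjoint W $$ (i, k) * W $$ (k, j))"
      using W ij by (intro index_mult_mat_sum) auto
    also have "\<dots> = (\<Sum>k<n. cnj (f i k) * f j k)"
      using ij by (intro sum.cong) (auto simp: W_def)
    finally show "(mat_adjoint W * W) $$ (i, j) = 1\<^sub>m n $$ (i, j)"
      using f(2)[OF ij] ij by simp
  qed (use W in auto)
  then have "unitary_mat n W" using W by (simp add: unitary_mat_def)
  moreover have "W $$ (i, 0) = v i" if "i < n" for i using that n f by (simp add: W_def)
  ultimately show thesis using that by blast
qed

section \<open>Diagonal matrices and singular value decompositions\<close>

definition diagonal_of :: "nat \<Rightarrow> (nat \<Rightarrow> real) \<Rightarrow> complex mat" where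
  "diagonal_of n s = mat n n (\<lambda>(i, j). if i = j then complex_of_real (s i) else 0)"

lemma diagonal_of_carrier [simp]: "diagonal_of n s \<in> carrier_mat n n"
  by (simp add: diagonal_of_def)

lemma mult_diagonal_of_index:
  assumes "A \<in> carrier_mat m n" "i < m" "j < n"
  shows "(A * diagonal_of n s) $$ (i, j) = A $$ (i, j) * s j"
proof -
  have "(A * diagonal_of n s) $$ (i, j) = (\<Sum>k<n. A $$ (i, k) * diagonal_of n s $$ (k, j))"
    using assms by (intro index_mult_mat_sum) auto
  also have "\<dots> = (\<Sum>k<n. if k = j then A $$ (i, j) * s j else 0)"
    using assms by (intro sum.cong) (auto simp: diagonal_of_def)
  finally show ?thesis using assms by simp
qed

lemma diagonal_of_mult_index:
  assumes "A \<in> carrier_mat n m" "i < n" "j < m"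
  shows "(diagonal_of n s * A) $$ (i, j) = s i * A $$ (i, j)"
proof -
  have "(diagonal_of n s * A) $$ (i, j) = (\<Sum>k<n. diagonal_of n s $$ (i, k) * A $$ (k, j))"
    using assms by (intro index_mult_mat_sum) auto
  also have "\<dots> = (\<Sum>k<n. if k = i then s i * A $$ (i, j) else 0)"
    using assms by (intro sum.cong) (auto simp: diagonal_of_def)
  finally show ?thesis using assms by simp
qed

lemma diagonal_of_mult: "diagonal_of n s * diagonal_of n t = diagonal_of n (\<lambda>i. s i * t i)"
proof (rule eq_matI)
  fix i j assume "i < dim_row (diagonal_of n (\<lambda>i. s i * t i))" "j < dim_col (diagonal_of n (\<lambda>i. s i * t i))"
  then have ij: "i < n" "j < n" by (auto simp: diagonal_of_def)
  show "(diagonal_of n s * diagonal_of n t) $$ (i, j) = diagonal_of n (\<lambda>i. s i * t i) $$ (i, j)"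
    by (subst mult_diagonal_of_index[of _ n]) (use ij in \<open>auto simp: diagonal_of_def\<close>)
qed (auto simp: diagonal_of_def)

text \<open>Nonnegativity of \<open>s\<close> is asked at every natural number, so that sign facts
  carry no index bound. The values come in no particular order and include the zero ones, since
  \<open>U\<close> and \<open>V\<close> are square.\<close>

definition is_svd :: "nat \<Rightarrow> complex mat \<Rightarrow> complex mat \<Rightarrow> (nat \<Rightarrow> real) \<Rightarrow> complex mat \<Rightarrow> bool" where
  "is_svd n M U s V \<longleftrightarrow> unitary_mat n U \<and> unitary_mat n V \<and> (\<forall>i. 0 \<le> s i)
     \<and> M = U * diagonal_of n s * mat_adjoint V"

lemma mult_diagonal_of_mult_index:
  assumes "A \<in> carrier_mat l n" "B \<in> carrier_mat n m" "i < l" "j < m"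
  shows "(A * diagonal_of n s * B) $$ (i, j) = (\<Sum>k<n. A $$ (i, k) * s k * B $$ (k, j))"
proof -
  have "A * diagonal_of n s \<in> carrier_mat l n" using assms by auto
  then have "(A * diagonal_of n s * B) $$ (i, j) = (\<Sum>k<n. (A * diagonal_of n s) $$ (i, k) * B $$ (k, j))"
    using assms by (intro index_mult_mat_sum) auto
  also have "\<dots> = (\<Sum>k<n. A $$ (i, k) * s k * B $$ (k, j))"
    using assms by (intro sum.cong) (auto simp: mult_diagonal_of_index simp del: index_mult_mat(1))
  finally show ?thesis .
qed

lemma is_svd_index:
  assumes "is_svd n M U s V" "i < n" "j < n"
  shows "M $$ (i, j) = (\<Sum>k<n. U $$ (i, k) * s k * cnj (V $$ (j, k)))"
proof -
  have UV: "U \<in> carrier_mat n n" "V \<in> carrier_mat n n" using assms by (auto simp: is_svd_def unitary_mat_def)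
  have "M $$ (i, j) = (\<Sum>k<n. U $$ (i, k) * s k * mat_adjoint V $$ (k, j))"
    using assms UV by (subst mult_diagonal_of_mult_index[of U n n "mat_adjoint V" n, symmetric]) (auto simp: is_svd_def)
  also have "\<dots> = (\<Sum>k<n. U $$ (i, k) * s k * cnj (V $$ (j, k)))"
    using assms UV by (intro sum.cong) auto
  finally show ?thesis .
qed

lemma is_svdI:
  assumes "unitary_mat n U" "unitary_mat n V" "\<And>i. 0 \<le> s i" "M \<in> carrier_mat n n"
    and "\<And>i j. i < n \<Longrightarrow> j < n \<Longrightarrow> M $$ (i, j) = (\<Sum>k<n. U $$ (i, k) * s k * cnj (V $$ (j, k)))"
  shows "is_svd n M U s V"
proof -
  have UV: "U \<in> carrier_mat n n" "V \<in> carrier_mat n n" using assms by (auto simp: unitary_mat_def)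
  have "M = U * diagonal_of n s * mat_adjoint V"
  proof (rule eq_matI)
    fix i j assume "i < dim_row (U * diagonal_of n s * mat_adjoint V)" "j < dim_col (U * diagonal_of n s * mat_adjoint V)"
    then have ij: "i < n" "j < n" using UV by auto
    have "(U * diagonal_of n s * mat_adjoint V) $$ (i, j) = (\<Sum>k<n. U $$ (i, k) * s k * mat_adjoint V $$ (k, j))"
      using ij UV by (intro mult_diagonal_of_mult_index) auto
    also have "\<dots> = (\<Sum>k<n. U $$ (i, k) * s k * cnj (V $$ (j, k)))"
      using ij UV by (intro sum.cong) auto
    finally show "M $$ (i, j) = (U * diagonal_of n s * mat_adjoint V) $$ (i, j)"
      using assms(5) ij by simp
  qed (use UV assms in auto)
  then show ?thesis using assms by (simp add: is_svd_def)
qed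

lemma is_svd_carrier: "is_svd n M U s V \<Longrightarrow> M \<in> carrier_mat n n"
  by (auto simp: is_svd_def unitary_mat_def)

lemma is_svd_unitary_mult:
  assumes M: "is_svd n M U s V" and E: "unitary_mat n E" "unitary_mat n F"
  shows "is_svd n (E * M * mat_adjoint F) (E * U) s (F * V)"
proof -
  have c: "E \<in> carrier_mat n n" "F \<in> carrier_mat n n" "U \<in> carrier_mat n n" "V \<in> carrier_mat n n"
    using assms by (auto simp: is_svd_def unitary_mat_def)
  have "E * (U * diagonal_of n s * mat_adjoint V) * mat_adjoint F = E * U * diagonal_of n s * (mat_adjoint V * mat_adjoint F)"
    using c by (simp add: assoc_mult_mat[of _ n n _ n _ n] mult_carrier_mat[of _ n n])
  then have "E * M * mat_adjoint F = E * U * diagonal_of n s * mat_adjoint (F * V)"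
    using M mat_adjoint_mult[OF c(2,4)] by (simp add: is_svd_def)
  then show ?thesis using assms by (auto simp: is_svd_def intro: unitary_mat_mult)
qed

lemma is_svd_adjoint:
  assumes "is_svd n M U s V"
  shows "is_svd n (mat_adjoint M) V s U"
proof (rule is_svdI)
  have c: "M \<in> carrier_mat n n" using assms by (rule is_svd_carrier)
  then show "mat_adjoint M \<in> carrier_mat n n" by simp
  fix i j assume ij: "i < n" "j < n"
  then have "mat_adjoint M $$ (i, j) = cnj (M $$ (j, i))" using c by auto
  then show "mat_adjoint M $$ (i, j) = (\<Sum>k<n. V $$ (i, k) * s k * cnj (U $$ (j, k)))"
    using is_svd_index[OF assms ij(2,1)] by (simp add: mult_ac)
qed (use assms in \<open>auto simp: is_svd_def\<close>)

section \<open>Existence of singular value decompositions\<close>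

text \<open>The characteristic polynomial of the Gram matrix splits over the complex numbers, which
  yields an eigenvector to normalise. At this point \<open>c\<close> is just a complex number; it is
  identified as a square in \<open>singular_vector_pair\<close>.\<close>

lemma gram_eigenvector:
  fixes M :: "complex mat"
  assumes M: "M \<in> carrier_mat n n" and n: "n > 0"
  obtains v c where "(\<Sum>i<n. (cmod (v i))\<^sup>2) = 1"
    "\<And>k. k < n \<Longrightarrow> (\<Sum>i<n. cnj (M $$ (i, k)) * (\<Sum>j<n. M $$ (i, j) * v j)) = c * v k"
proof -
  define H where "H = mat_adjoint M * M"
  have H: "H \<in> carrier_mat n n" using M by (auto simp: H_def)
  obtain as where as: "char_poly H = (\<Prod>a\<leftarrow>as. [:- a, 1:])" "length as = n"
    using char_poly_factorized[OF H] by blast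
  then obtain c as' where "as = c # as'" using n by (cases as) auto
  then have "poly (char_poly H) c = 0" by (simp add: as)
  then have "eigenvalue H c" using eigenvalue_root_char_poly[OF H] by simp
  then obtain w where w: "w \<in> carrier_vec n" "w \<noteq> 0\<^sub>v n" "H *\<^sub>v w = c \<cdot>\<^sub>v w"
    using H unfolding eigenvalue_def eigenvector_def by auto
  obtain v d where v: "(\<Sum>i<n. (cmod (v i))\<^sup>2) = 1" "\<And>i. v i = d * w $ i"
    using normalize_vec[OF w(1,2)] by blast
  have "(\<Sum>i<n. cnj (M $$ (i, k)) * (\<Sum>j<n. M $$ (i, j) * v j)) = c * v k" if k: "k < n" for k
  proof -
    have "c * v k = d * (c \<cdot>\<^sub>v w) $ k" using k w(1) by (simp add: v)
    also have "\<dots> = d * (\<Sum>j<n. H $$ (k, j) * w $ j)"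
      using k w(1) H unfolding w(3)[symmetric] by (auto simp: scalar_prod_def atLeast0LessThan)
    also have "\<dots> = (\<Sum>j<n. H $$ (k, j) * v j)" by (simp add: v sum_distrib_left mult_ac)
    also have "\<dots> = (\<Sum>j<n. (\<Sum>i<n. cnj (M $$ (i, k)) * M $$ (i, j)) * v j)"
    proof (intro sum.cong refl arg_cong[where f = "\<lambda>x. x * _"])
      fix j assume "j \<in> {..<n}"
      then have "H $$ (k, j) = (\<Sum>i<n. mat_adjoint M $$ (k, i) * M $$ (i, j))"
        unfolding H_def using k M by (intro index_mult_mat_sum) auto
      also have "\<dots> = (\<Sum>i<n. cnj (M $$ (i, k)) * M $$ (i, j))"
        using k M by (intro sum.cong) auto
      finally show "H $$ (k, j) = (\<Sum>i<n. cnj (M $$ (i, k)) * M $$ (i, j))" .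
    qed
    also have "\<dots> = (\<Sum>i<n. cnj (M $$ (i, k)) * (\<Sum>j<n. M $$ (i, j) * v j))"
      unfolding sum_distrib_left sum_distrib_right by (subst sum.swap) (simp add: mult_ac)
    finally show ?thesis by simp
  qed
  then show thesis using that[of v c] v(1) by blast
qed

text \<open>For a unit eigenvector \<open>v\<close> of the Gram matrix, \<open>s\<close> is the
  length of M v, and u = M v / s if s is not 0. If s = 0, then \<open>M\<close> is singular and
  \<open>u\<close> is a unit vector in the kernel of its adjoint.\<close>

lemma singular_vector_pair:
  fixes M :: "complex mat"
  assumes M: "M \<in> carrier_mat n n" and n: "n > 0"
  obtains u v s where "(\<Sum>i<n. (cmod (u i))\<^sup>2) = 1" "(\<Sum>i<n. (cmod (v i))\<^sup>2) = 1" "0 \<le> s"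
    "\<And>i. i < n \<Longrightarrow> (\<Sum>j<n. M $$ (i, j) * v j) = complex_of_real s * u i"
    "\<And>k. k < n \<Longrightarrow> (\<Sum>i<n. cnj (u i) * M $$ (i, k)) = complex_of_real s * cnj (v k)"
proof -
  obtain v c where v: "(\<Sum>i<n. (cmod (v i))\<^sup>2) = 1"
    and eig: "\<And>k. k < n \<Longrightarrow> (\<Sum>i<n. cnj (M $$ (i, k)) * (\<Sum>j<n. M $$ (i, j) * v j)) = c * v k"
    using gram_eigenvector[OF M n] by blast
  define x where "x i = (\<Sum>j<n. M $$ (i, j) * v j)" for i
  define s where "s = sqrt (\<Sum>i<n. (cmod (x i))\<^sup>2)"
  have s2: "s\<^sup>2 = (\<Sum>i<n. (cmod (x i))\<^sup>2)" by (simp add: s_def sum_nonneg)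
  have s0: "s \<ge> 0" by (simp add: s_def sum_nonneg)
  \<comment> \<open>Pairing the eigenvector equation with \<open>v\<close> gives
    \<open>c = s\<^sup>2\<close>.\<close>
  have "complex_of_real (s\<^sup>2) = (\<Sum>i<n. cnj (x i) * x i)" unfolding s2 by (simp add: cnj_mult_self)
  also have "\<dots> = (\<Sum>i<n. \<Sum>k<n. cnj (v k) * (cnj (M $$ (i, k)) * x i))"
    by (subst x_def) (simp add: sum_distrib_left sum_distrib_right mult_ac)
  also have "\<dots> = (\<Sum>k<n. cnj (v k) * (\<Sum>i<n. cnj (M $$ (i, k)) * x i))"
    by (subst sum.swap) (simp add: sum_distrib_left)
  also have "\<dots> = (\<Sum>k<n. cnj (v k) * (c * v k))"
    using eig by (intro sum.cong) (auto simp: x_def)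
  also have "\<dots> = c * (\<Sum>k<n. cnj (v k) * v k)" by (simp add: sum_distrib_left mult_ac)
  also have "(\<Sum>k<n. cnj (v k) * v k) = complex_of_real (\<Sum>i<n. (cmod (v i))\<^sup>2)" by (simp add: cnj_mult_self)
  finally have c: "c = complex_of_real (s\<^sup>2)" using v by simp
  have "\<exists>u :: nat \<Rightarrow> complex. (\<Sum>i<n. (cmod (u i))\<^sup>2) = 1 \<and> (\<forall>i<n. x i = s * u i) \<and> (\<forall>k<n. (\<Sum>i<n. cnj (u i) * M $$ (i, k)) = s * cnj (v k))"
  proof (cases "s = 0")
    case False
    define u where "u i = x i / s" for i
    have "(\<Sum>i<n. (cmod (u i))\<^sup>2) = (\<Sum>i<n. (cmod (x i))\<^sup>2) / s\<^sup>2"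
      by (simp add: u_def norm_divide power_divide sum_divide_distrib)
    then have 1: "(\<Sum>i<n. (cmod (u i))\<^sup>2) = 1" using False by (simp add: s2[symmetric])
    have 2: "x i = s * u i" for i using False by (simp add: u_def)
    have 3: "(\<Sum>i<n. cnj (u i) * M $$ (i, k)) = s * cnj (v k)" if k: "k < n" for k
    proof -
      have "(\<Sum>i<n. cnj (u i) * M $$ (i, k)) = cnj (\<Sum>i<n. cnj (M $$ (i, k)) * x i) / s"
        by (simp add: u_def sum_divide_distrib mult_ac)
      also have "\<dots> = cnj (c * v k) / s" using eig[OF k] by (simp add: x_def)
      finally show ?thesis using False by (simp add: c power2_eq_square)
    qed
    show ?thesis using 1 2 3 by blast
  next
    case True
    then have x0: "x i = 0" if "i < n" for i
      using s2 that by (simp add: sum_nonneg_eq_0_iff)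
    obtain V where V: "unitary_mat n V" "\<And>i. i < n \<Longrightarrow> V $$ (i, 0) = v i"
      using unitary_extension[OF n v] by blast
    note Vc = unitary_matD(1)[OF V(1)]
    \<comment> \<open>As \<open>v\<close> is the first column of \<open>V\<close> and M v = 0, the
      first column of \<open>M * V\<close> vanishes, and with it the first row of \<open>N\<close>.
      A kernel vector of \<open>N\<close> is the required \<open>u\<close>.\<close>
    define N where "N = mat_adjoint (M * V)"
    have N: "N \<in> carrier_mat n n" using M Vc by (auto simp: N_def)
    have MV: "(M * V) $$ (j, i) = (\<Sum>k<n. M $$ (j, k) * V $$ (k, i))" if "i < n" "j < n" for i j
      using that M Vc by (intro index_mult_mat_sum) auto
    have N_index: "N $$ (i, j) = (\<Sum>k<n. cnj (M $$ (j, k)) * cnj (V $$ (k, i)))" if "i < n" "j < n" for i j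
      unfolding N_def using that M Vc MV[OF that] by (subst mat_adjoint_index) (auto simp del: index_mult_mat(1))
    have "N $$ (0, j) = 0" if j: "j < n" for j
    proof -
      have "N $$ (0, j) = cnj (x j)" using j n V(2) by (simp add: N_index x_def)
      then show ?thesis using x0 j by simp
    qed
    from unit_kernel_vector[OF N n this]
    obtain u where u: "(\<Sum>i<n. (cmod (u i))\<^sup>2) = 1" "\<And>i. i < n \<Longrightarrow> (\<Sum>j<n. N $$ (i, j) * u j) = 0" by blast
    define w where "w k = (\<Sum>j<n. cnj (M $$ (j, k)) * u j)" for k
    have w: "(\<Sum>k<n. cnj (V $$ (k, i)) * w k) = 0" if i: "i < n" for i
    proof -
      have "(\<Sum>k<n. cnj (V $$ (k, i)) * w k) = (\<Sum>j<n. N $$ (i, j) * u j)"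
        using i unfolding w_def sum_distrib_left
        by (subst sum.swap) (auto simp: N_index sum_distrib_left sum_distrib_right mult_ac intro!: sum.cong)
      then show ?thesis using u(2)[OF i] by simp
    qed
    \<comment> \<open>The columns of \<open>V\<close> form an orthonormal basis, and all
      coefficients of \<open>w\<close> in this basis vanish.\<close>
    have "w k = 0" if k: "k < n" for k
    proof -
      have "w k = (\<Sum>l<n. (if k = l then 1 else 0) * w l)" using k by (simp add: if_distrib[of "\<lambda>x. x * _"] cong: if_cong)
      also have "\<dots> = (\<Sum>l<n. (\<Sum>i<n. V $$ (k, i) * cnj (V $$ (l, i))) * w l)"
        using k by (intro sum.cong) (auto simp: unitary_mat_rows[OF V(1)])
      also have "\<dots> = (\<Sum>i<n. V $$ (k, i) * (\<Sum>l<n. cnj (V $$ (l, i)) * w l))"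
        unfolding sum_distrib_left sum_distrib_right by (subst sum.swap) (simp add: mult_ac)
      also have "\<dots> = 0" using w by simp
      finally show ?thesis .
    qed
    moreover have "(\<Sum>i<n. cnj (u i) * M $$ (i, k)) = cnj (w k)" for k by (simp add: w_def mult_ac)
    ultimately show ?thesis using u(1) x0 True by auto
  qed
  then show thesis using that v s0 by (auto simp: x_def)
qed

definition bordered_mat :: "nat \<Rightarrow> complex mat \<Rightarrow> complex mat" where
  "bordered_mat n X = mat (Suc n) (Suc n) (\<lambda>(i, j). case (i, j) of
     (0, 0) \<Rightarrow> 1 | (Suc i', Suc j') \<Rightarrow> X $$ (i', j') | _ \<Rightarrow> 0)"

lemma bordered_mat_index:
  "bordered_mat n X $$ (0, 0) = 1"
  "j < n \<Longrightarrow> bordered_mat n X $$ (0, Suc j) = 0"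
  "i < n \<Longrightarrow> bordered_mat n X $$ (Suc i, 0) = 0"
  "i < n \<Longrightarrow> j < n \<Longrightarrow> bordered_mat n X $$ (Suc i, Suc j) = X $$ (i, j)"
  by (auto simp: bordered_mat_def)

lemma unitary_bordered_mat:
  assumes X: "unitary_mat n X"
  shows "unitary_mat (Suc n) (bordered_mat n X)"
proof -
  let ?B = "bordered_mat n X"
  have B: "?B \<in> carrier_mat (Suc n) (Suc n)" by (simp add: bordered_mat_def)
  have "mat_adjoint ?B * ?B = 1\<^sub>m (Suc n)"
  proof (rule eq_matI)
    fix i j assume "i < dim_row (1\<^sub>m (Suc n) :: complex mat)" "j < dim_col (1\<^sub>m (Suc n) :: complex mat)"
    then have ij: "i < Suc n" "j < Suc n" by auto
    have "(mat_adjoint ?B * ?B) $$ (i, j) = (\<Sum>k<Suc n. mat_adjoint ?B $$ (i, k) * ?B $$ (k, j))"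
      using B ij by (intro index_mult_mat_sum) auto
    also have "\<dots> = (\<Sum>k<Suc n. cnj (?B $$ (k, i)) * ?B $$ (k, j))"
      using B ij by (intro sum.cong) auto
    also have "\<dots> = (if i = j then 1 else 0)"
      using ij unitary_mat_cols[OF X]
      by (cases i; cases j) (simp_all add: sum.lessThan_Suc_shift bordered_mat_index del: sum.lessThan_Suc)
    finally show "(mat_adjoint ?B * ?B) $$ (i, j) = 1\<^sub>m (Suc n) $$ (i, j)" using ij by simp
  qed (use B in auto)
  then show ?thesis using B by (simp add: unitary_mat_def)
qed

text \<open>Induction on the size. If \<open>U\<close> and \<open>V\<close> begin with a pair of
  singular vectors, the first row and column of \<open>B\<close>, which is \<open>M\<close> in these
  bases, are zero off the corner entry \<open>s\<close>. The remaining block \<open>C\<close> is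
  decomposed by the induction hypothesis.\<close>

lemma svd_exists:
  fixes M :: "complex mat"
  assumes "M \<in> carrier_mat n n"
  shows "\<exists>U s V. is_svd n M U s V"
  using assms
proof (induction n arbitrary: M)
  case 0
  have "unitary_mat 0 (1\<^sub>m 0)" unfolding unitary_mat_def
    by (intro conjI one_carrier_mat eq_matI) simp_all
  then have "is_svd 0 M (1\<^sub>m 0) (\<lambda>_. 0) (1\<^sub>m 0)"
    using 0 by (intro is_svdI) auto
  then show ?case by blast
next
  case (Suc n)
  let ?N = "Suc n"
  note M = Suc.prems
  obtain u v :: "nat \<Rightarrow> complex" and s where u: "(\<Sum>i<?N. (cmod (u i))\<^sup>2) = 1" and v: "(\<Sum>i<?N. (cmod (v i))\<^sup>2) = 1" and s: "0 \<le> s"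
    and Mv: "\<And>i. i < ?N \<Longrightarrow> (\<Sum>j<?N. M $$ (i, j) * v j) = complex_of_real s * u i"
    and uM: "\<And>k. k < ?N \<Longrightarrow> (\<Sum>i<?N. cnj (u i) * M $$ (i, k)) = complex_of_real s * cnj (v k)"
    by (rule singular_vector_pair[OF M zero_less_Suc]) (rule that)
  obtain U where U: "unitary_mat ?N U" "\<And>i. i < ?N \<Longrightarrow> U $$ (i, 0) = u i"
    by (rule unitary_extension[OF zero_less_Suc u]) (rule that)
  obtain V where V: "unitary_mat ?N V" "\<And>i. i < ?N \<Longrightarrow> V $$ (i, 0) = v i"
    by (rule unitary_extension[OF zero_less_Suc v]) (rule that)
  note Uc = unitary_matD[OF U(1)] and Vc = unitary_matD[OF V(1)]
  define B where "B = mat_adjoint U * M * V"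
  have B: "B \<in> carrier_mat ?N ?N" unfolding B_def using Uc(1) Vc(1) M by (simp add: mult_carrier_mat[of _ ?N ?N])
  have UM: "(mat_adjoint U * M) $$ (i, k) = (\<Sum>l<?N. cnj (U $$ (l, i)) * M $$ (l, k))" if "i < ?N" "k < ?N" for i k
  proof -
    have "(mat_adjoint U * M) $$ (i, k) = (\<Sum>l<?N. mat_adjoint U $$ (i, l) * M $$ (l, k))"
      using that Uc(1) M by (intro index_mult_mat_sum) auto
    also have "\<dots> = (\<Sum>l<?N. cnj (U $$ (l, i)) * M $$ (l, k))"
      using that Uc(1) by (intro sum.cong) auto
    finally show ?thesis .
  qed
  have B_index: "B $$ (i, j) = (\<Sum>k<?N. (\<Sum>l<?N. cnj (U $$ (l, i)) * M $$ (l, k)) * V $$ (k, j))"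
    if "i < ?N" "j < ?N" for i j
  proof -
    have "B $$ (i, j) = (\<Sum>k<?N. (mat_adjoint U * M) $$ (i, k) * V $$ (k, j))"
      unfolding B_def using that Uc(1) Vc(1) M by (intro index_mult_mat_sum) (auto simp: mult_carrier_mat[of _ ?N ?N])
    then show ?thesis using that UM by simp
  qed
  have B_col0: "B $$ (i, 0) = (if i = 0 then complex_of_real s else 0)" if i: "i < ?N" for i
  proof -
    have "B $$ (i, 0) = (\<Sum>k<?N. \<Sum>l<?N. cnj (U $$ (l, i)) * M $$ (l, k) * v k)"
      using i V(2) unfolding B_index[OF i zero_less_Suc] sum_distrib_right by (intro sum.cong) auto
    also have "\<dots> = (\<Sum>l<?N. cnj (U $$ (l, i)) * (\<Sum>k<?N. M $$ (l, k) * v k))"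
      by (subst sum.swap) (simp only: sum_distrib_left mult_ac)
    also have "\<dots> = (\<Sum>l<?N. s * (cnj (U $$ (l, i)) * U $$ (l, 0)))"
      using Mv U(2) by (intro sum.cong) auto
    also have "\<dots> = s * (\<Sum>l<?N. cnj (U $$ (l, i)) * U $$ (l, 0))"
      by (simp only: sum_distrib_left)
    finally show ?thesis using unitary_mat_cols[OF U(1) i zero_less_Suc] by simp
  qed
  have B_row0: "B $$ (0, j) = (if j = 0 then complex_of_real s else 0)" if j: "j < ?N" for j
  proof -
    have "B $$ (0, j) = (\<Sum>k<?N. (\<Sum>l<?N. cnj (u l) * M $$ (l, k)) * V $$ (k, j))"
      using j U(2) unfolding B_index[OF zero_less_Suc j] by simp
    also have "\<dots> = (\<Sum>k<?N. s * (cnj (V $$ (k, 0)) * V $$ (k, j)))"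
      using uM V(2) by (intro sum.cong) auto
    also have "\<dots> = s * (\<Sum>k<?N. cnj (V $$ (k, 0)) * V $$ (k, j))"
      by (simp only: sum_distrib_left)
    finally show ?thesis using unitary_mat_cols[OF V(1) zero_less_Suc j] by simp
  qed
  define C where "C = mat n n (\<lambda>(i, j). B $$ (Suc i, Suc j))"
  have "C \<in> carrier_mat n n" by (simp add: C_def)
  then obtain X t Y where svd: "is_svd n C X t Y" using Suc.IH by blast
  then have XY: "unitary_mat n X" "unitary_mat n Y" "\<And>i. t i \<ge> 0" by (auto simp: is_svd_def)
  have "is_svd ?N B (bordered_mat n X) (case_nat s t) (bordered_mat n Y)"
  proof (rule is_svdI)
    show "0 \<le> (case i of 0 \<Rightarrow> s | Suc x \<Rightarrow> t x)" for i using s XY(3) by (cases i) auto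
    fix i j assume ij: "i < ?N" "j < ?N"
    have inner: "B $$ (Suc i', Suc j') = (\<Sum>k<n. X $$ (i', k) * t k * cnj (Y $$ (j', k)))" if "i' < n" "j' < n" for i' j'
      using is_svd_index[OF svd that] that by (simp add: C_def)
    show "B $$ (i, j) = (\<Sum>k<?N. bordered_mat n X $$ (i, k) * complex_of_real (case k of 0 \<Rightarrow> s | Suc x \<Rightarrow> t x)
        * cnj (bordered_mat n Y $$ (j, k)))"
      using ij B_col0 B_row0 inner
      by (cases i; cases j) (simp_all add: sum.lessThan_Suc_shift bordered_mat_index del: sum.lessThan_Suc)
  qed (use XY B in \<open>auto intro: unitary_bordered_mat\<close>)
  then have "is_svd ?N (U * B * mat_adjoint V) (U * bordered_mat n X) (case_nat s t) (V * bordered_mat n Y)"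
    using U(1) V(1) by (rule is_svd_unitary_mult)
  moreover have "U * B * mat_adjoint V = M"
  proof -
    have "U * B * mat_adjoint V = (U * mat_adjoint U) * M * (V * mat_adjoint V)"
      unfolding B_def using Uc(1) Vc(1) M
      by (simp add: assoc_mult_mat[of _ ?N ?N _ ?N _ ?N] mult_carrier_mat[of _ ?N ?N])
    then show ?thesis using Uc(3) Vc(3) M by simp
  qed
  ultimately show ?case by auto
qed

text \<open>The Gram matrix is similar to the diagonal matrix of the squares of \<open>s\<close>, so
  these are the roots of its characteristic polynomial with multiplicity. This ties the definition
  by \<open>proots\<close> to every decomposition of \<open>M\<close>.\<close>

lemma sum_mset_singular_values:
  assumes svd: "is_svd n M U s V"
  shows "(\<Sum>x\<in>#singular_values M. f x) = (\<Sum>i<n. f (s i))"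
proof -
  have UV: "unitary_mat n U" "unitary_mat n V" and s: "\<And>i. 0 \<le> s i"
    using svd by (auto simp: is_svd_def)
  note Uc = unitary_matD[OF UV(1)] and Vc = unitary_matD[OF UV(2)]
  let ?D = "diagonal_of n s" and ?E = "diagonal_of n (\<lambda>i. s i * s i)"
  have M: "M = U * ?D * mat_adjoint V" using svd by (simp add: is_svd_def)
  have "mat_adjoint M = V * ?D * mat_adjoint U"
    using is_svd_adjoint[OF svd] by (simp add: is_svd_def)
  then have "mat_adjoint M * M = V * (?D * (mat_adjoint U * U) * ?D) * mat_adjoint V"
    unfolding M using Uc(1) Vc(1)
    by (simp add: assoc_mult_mat[of _ n n _ n _ n] mult_carrier_mat[of _ n n])
  then have MM: "mat_adjoint M * M = V * ?E * mat_adjoint V"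
    unfolding Uc(2) by (simp add: diagonal_of_mult right_mult_one_mat[of _ n n])
  have "similar_mat_wit (mat_adjoint M * M) ?E V (mat_adjoint V)"
    using Vc MM by (intro similar_mat_witI[of _ _ n]) (auto simp: mult_carrier_mat[of _ n n])
  then have "similar_mat (mat_adjoint M * M) ?E" unfolding similar_mat_def by blast
  then have "char_poly (mat_adjoint M * M) = char_poly ?E" by (rule char_poly_similar)
  also have "\<dots> = (\<Prod>a\<leftarrow>diag_mat ?E. [:- a, 1:])"
    by (rule char_poly_upper_triangular[of _ n]) (auto simp: diagonal_of_def)
  finally have cp: "char_poly (mat_adjoint M * M) = (\<Prod>a\<leftarrow>diag_mat ?E. [:- a, 1:])" .
  have "proots (\<Prod>a\<leftarrow>as. [:- a, 1:]) = mset as" for as :: "complex list"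
  proof (induction as)
    case (Cons a as)
    have "proots ([:- a, 1:] * (\<Prod>a\<leftarrow>as. [:- a, 1:])) = proots [:- a, 1:] + proots (\<Prod>a\<leftarrow>as. [:- a, 1:])"
      by (rule proots_mult) (auto simp: prod_list_zero_iff)
    then show ?case using Cons.IH by (simp del: mult_pCons_left)
  qed simp
  then have "proots (char_poly (mat_adjoint M * M)) = mset (diag_mat ?E)" by (simp add: cp)
  also have "diag_mat ?E = map (\<lambda>i. complex_of_real (s i * s i)) [0..<n]"
    by (auto simp: diag_mat_def diagonal_of_def)
  finally have "singular_values M = mset (map s [0..<n])"
    unfolding singular_values_def using s by (simp add: multiset.map_comp comp_def flip: mset_map)
  then show ?thesis
    by (simp add: sum_mset_sum_list flip: mset_map) (simp add: interv_sum_list_conv_sum_set_nat atLeast0LessThan)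
qed

section \<open>Strong monotonicity of the gradient\<close>

definition schatten_power :: "real \<Rightarrow> complex mat \<Rightarrow> real" where
  "schatten_power p M = (\<Sum>s\<in>#singular_values M. s powr p)"

lemma schatten_power_svd:
  "is_svd n M U s V \<Longrightarrow> schatten_power p M = (\<Sum>i<n. s i powr p)"
  by (simp add: schatten_power_def sum_mset_singular_values)

text \<open>The real part of the trace of adjoint(A) B: the Euclidean inner product on matrices as a
  real vector space, with respect to which gradients are taken.\<close>

definition mat_inner :: "nat \<Rightarrow> complex mat \<Rightarrow> complex mat \<Rightarrow> real" where
  "mat_inner n A B = Re (\<Sum>i<n. \<Sum>j<n. cnj (A $$ (i, j)) * B $$ (i, j))"

lemma mat_inner_commute: "mat_inner n A B = mat_inner n B A"
  by (simp add: mat_inner_def mult.commute)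

lemma adjoint_mult_index:
  fixes U V :: "complex mat"
  assumes "U \<in> carrier_mat n m" "V \<in> carrier_mat n l" "i < m" "j < l"
  shows "(mat_adjoint U * V) $$ (i, j) = (\<Sum>k<n. cnj (U $$ (k, i)) * V $$ (k, j))"
proof -
  have "(mat_adjoint U * V) $$ (i, j) = (\<Sum>k<n. mat_adjoint U $$ (i, k) * V $$ (k, j))"
    using assms by (intro index_mult_mat_sum) auto
  then show ?thesis using assms by simp
qed

lemma sum_sum_product_cnj:
  fixes f g :: "'a \<Rightarrow> complex"
  shows "(\<Sum>i\<in>A. \<Sum>j\<in>B. c * (f i * cnj (g j))) = c * ((\<Sum>i\<in>A. f i) * cnj (\<Sum>j\<in>B. g j))"
  unfolding cnj_sum sum_product by (simp only: sum_distrib_left)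

text \<open>For each pair of singular values, the sum over matrix entries factors into an overlap of
  left singular vectors and an overlap of right ones.\<close>

lemma mat_inner_svd:
  assumes A: "is_svd n A U s V" and B: "is_svd n B U' t V'"
  shows "mat_inner n A B = (\<Sum>k<n. \<Sum>l<n. s k * t l *
     Re ((mat_adjoint U * U') $$ (k, l) * cnj ((mat_adjoint V * V') $$ (k, l))))"
proof -
  have c: "U \<in> carrier_mat n n" "V \<in> carrier_mat n n" "U' \<in> carrier_mat n n" "V' \<in> carrier_mat n n"
    using A B by (auto simp: is_svd_def unitary_mat_def)
  have "(\<Sum>i<n. \<Sum>j<n. cnj (A $$ (i, j)) * B $$ (i, j))
      = (\<Sum>i<n. \<Sum>j<n. \<Sum>k<n. \<Sum>l<n. of_real (s k * t l) * ((cnj (U $$ (i, k)) * U' $$ (i, l)) * cnj (cnj (V $$ (j, k)) * V' $$ (j, l))))"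
    by (intro sum.cong refl) (auto simp: is_svd_index[OF A] is_svd_index[OF B] sum_product mult_ac)
  also have "\<dots> = (\<Sum>k<n. \<Sum>l<n. \<Sum>i<n. \<Sum>j<n. of_real (s k * t l) * ((cnj (U $$ (i, k)) * U' $$ (i, l)) * cnj (cnj (V $$ (j, k)) * V' $$ (j, l))))"
    by (subst (2) sum.swap, subst sum.swap, rule sum.cong[OF refl], subst (3) sum.swap, subst sum.swap, rule refl)
  also have "\<dots> = (\<Sum>k<n. \<Sum>l<n. of_real (s k * t l) * ((mat_adjoint U * U') $$ (k, l) * cnj ((mat_adjoint V * V') $$ (k, l))))"
    unfolding sum_sum_product_cnj using c
    by (intro sum.cong refl) (simp add: adjoint_mult_index[where n = n and m = n and l = n] del: index_mult_mat(1))
  finally show ?thesis by (simp add: mat_inner_def del: index_mult_mat(1))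
qed

lemma mat_inner_svd_same:
  assumes A: "is_svd n A U s V" and B: "is_svd n B U t V"
  shows "mat_inner n A B = (\<Sum>k<n. s k * t k)"
proof -
  have "mat_adjoint U * U = 1\<^sub>m n" "mat_adjoint V * V = 1\<^sub>m n"
    using A by (auto simp: is_svd_def unitary_mat_def)
  then have "mat_inner n A B = (\<Sum>k<n. \<Sum>l<n. if l = k then s k * t k else 0)"
    unfolding mat_inner_svd[OF A B] by (intro sum.cong refl) auto
  then show ?thesis by simp
qed

lemma mat_inner_self: "mat_inner n A A = (\<Sum>i<n. \<Sum>j<n. (cmod (A $$ (i, j)))\<^sup>2)"
  by (simp add: mat_inner_def cnj_mult_self flip: of_real_power)

text \<open>Both sides are the diagonal entry at \<open>i\<close> of A adjoint(A); orthonormality of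
  the columns of \<open>V\<close> removes the cross terms.\<close>

lemma svd_row_norm:
  assumes A: "is_svd n A U s V" and i: "i < n"
  shows "(\<Sum>j<n. (cmod (A $$ (i, j)))\<^sup>2) = (\<Sum>k<n. (s k)\<^sup>2 * (cmod (U $$ (i, k)))\<^sup>2)"
proof -
  have V: "unitary_mat n V" using A by (simp add: is_svd_def)
  have "complex_of_real (\<Sum>j<n. (cmod (A $$ (i, j)))\<^sup>2) = (\<Sum>j<n. cnj (A $$ (i, j)) * A $$ (i, j))"
    by (simp add: cnj_mult_self)
  also have "\<dots> = (\<Sum>j<n. \<Sum>k<n. \<Sum>l<n. of_real (s k * s l) * (cnj (U $$ (i, l)) * U $$ (i, k)) * (cnj (V $$ (j, k)) * V $$ (j, l)))"
    by (intro sum.cong refl) (auto simp: is_svd_index[OF A i] sum_product mult_ac)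
  also have "\<dots> = (\<Sum>k<n. \<Sum>l<n. \<Sum>j<n. of_real (s k * s l) * (cnj (U $$ (i, l)) * U $$ (i, k)) * (cnj (V $$ (j, k)) * V $$ (j, l)))"
    by (subst sum.swap, rule sum.cong[OF refl], rule sum.swap)
  also have "\<dots> = (\<Sum>k<n. \<Sum>l<n. of_real (s k * s l) * (cnj (U $$ (i, l)) * U $$ (i, k)) * (if l = k then 1 else 0))"
    unfolding sum_distrib_left[symmetric] by (intro sum.cong refl) (auto simp: unitary_mat_cols[OF V])
  also have "\<dots> = (\<Sum>k<n. \<Sum>l<n. if l = k then of_real (s k * s k) * (cnj (U $$ (i, k)) * U $$ (i, k)) else 0)"
    by (intro sum.cong refl) auto
  also have "\<dots> = complex_of_real (\<Sum>k<n. (s k)\<^sup>2 * (cmod (U $$ (i, k)))\<^sup>2)"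
    by (simp add: cnj_mult_self power2_eq_square[of "complex_of_real (s _)"])
  finally show ?thesis using of_real_eq_iff by blast
qed

lemma svd_col_norm:
  assumes A: "is_svd n A U s V" and j: "j < n"
  shows "(\<Sum>i<n. (cmod (A $$ (i, j)))\<^sup>2) = (\<Sum>k<n. (s k)\<^sup>2 * (cmod (V $$ (j, k)))\<^sup>2)"
proof -
  have c: "A \<in> carrier_mat n n" using A by (rule is_svd_carrier)
  have "(\<Sum>i<n. (cmod (mat_adjoint A $$ (j, i)))\<^sup>2) = (\<Sum>i<n. (cmod (A $$ (i, j)))\<^sup>2)"
    using c j by (intro sum.cong) auto
  then show ?thesis using svd_row_norm[OF is_svd_adjoint[OF A] j] by simp
qed

section \<open>Compression to singular vectors and the resulting lower bound\<close>

text \<open>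
  Left multiplication by \<open>diag a\<close> and right multiplication by \<open>diag b\<close> are simultaneously diagonal
  in the matrix units. Compressed to the span of the rank-one matrices formed from the left and right
  singular vectors of \<open>P\<close>, half their sum is still diagonal, with entries \<open>d k\<close>. The following
  is the operator Jensen inequality for the function \<open>x \<mapsto> 1 / (t + x)\<close> and this compression.
\<close>

lemma resolvent_compression:
  fixes a b :: "nat \<Rightarrow> real"
  assumes P: "is_svd n P E y F"
    and ab: "\<And>i. a i \<ge> 0" "\<And>i. b i \<ge> 0"
    and zero: "\<And>i j. i < n \<Longrightarrow> j < n \<Longrightarrow> a i + b j = 0 \<Longrightarrow> P $$ (i, j) = 0"
    and t: "t \<ge> 0"
  defines "d \<equiv> \<lambda>k. ((\<Sum>i<n. a i * (cmod (E $$ (i, k)))\<^sup>2) + (\<Sum>j<n. b j * (cmod (F $$ (j, k)))\<^sup>2)) / 2"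
  shows "(\<Sum>k<n. (y k)\<^sup>2 / (t + d k)) \<le> (\<Sum>i<n. \<Sum>j<n. (cmod (P $$ (i, j)))\<^sup>2 / (t + (a i + b j) / 2))"
proof -
  \<comment> \<open>Let L multiply entry (i, j) by \<open>(a i + b j) / 2\<close>. Among
    combinations of the rank-one matrices of singular vectors of \<open>P\<close>, the matrix
    \<open>T\<close> with these coefficients maximises 2 <P, T> - <T, (t + L) T>. Its value there is
    the left side, while \<open>point\<close> bounds the value at any matrix by the right
    side.\<close>
  define \<tau> where "\<tau> k = y k / (t + d k)" for k
  have d0: "d k \<ge> 0" for k unfolding d_def using ab by (simp add: sum_nonneg)
  have E: "unitary_mat n E" "unitary_mat n F" "\<And>i. y i \<ge> 0" using P by (auto simp: is_svd_def)
  define T where "T = E * diagonal_of n \<tau> * mat_adjoint F"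
  have T: "is_svd n T E \<tau> F"
    unfolding is_svd_def T_def using E d0 t by (auto simp: \<tau>_def)
  have PT: "mat_inner n P T = (\<Sum>k<n. y k * \<tau> k)" by (rule mat_inner_svd_same[OF P T])
  have row: "(\<Sum>i<n. \<Sum>j<n. a i * (cmod (T $$ (i, j)))\<^sup>2) = (\<Sum>k<n. (\<tau> k)\<^sup>2 * (\<Sum>i<n. a i * (cmod (E $$ (i, k)))\<^sup>2))"
  proof -
    have "(\<Sum>i<n. \<Sum>j<n. a i * (cmod (T $$ (i, j)))\<^sup>2) = (\<Sum>i<n. a i * (\<Sum>k<n. (\<tau> k)\<^sup>2 * (cmod (E $$ (i, k)))\<^sup>2))"
      by (simp add: svd_row_norm[OF T, symmetric] sum_distrib_left)
    also have "\<dots> = (\<Sum>k<n. (\<tau> k)\<^sup>2 * (\<Sum>i<n. a i * (cmod (E $$ (i, k)))\<^sup>2))"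
      unfolding sum_distrib_left by (subst sum.swap) (simp add: mult_ac)
    finally show ?thesis .
  qed
  have col: "(\<Sum>i<n. \<Sum>j<n. b j * (cmod (T $$ (i, j)))\<^sup>2) = (\<Sum>k<n. (\<tau> k)\<^sup>2 * (\<Sum>j<n. b j * (cmod (F $$ (j, k)))\<^sup>2))"
  proof -
    have "(\<Sum>i<n. \<Sum>j<n. b j * (cmod (T $$ (i, j)))\<^sup>2) = (\<Sum>j<n. b j * (\<Sum>k<n. (\<tau> k)\<^sup>2 * (cmod (F $$ (j, k)))\<^sup>2))"
      by (subst sum.swap) (simp add: svd_col_norm[OF T, symmetric] sum_distrib_left)
    also have "\<dots> = (\<Sum>k<n. (\<tau> k)\<^sup>2 * (\<Sum>j<n. b j * (cmod (F $$ (j, k)))\<^sup>2))"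
      unfolding sum_distrib_left by (subst sum.swap) (simp add: mult_ac)
    finally show ?thesis .
  qed
  have tot: "(\<Sum>i<n. \<Sum>j<n. (cmod (T $$ (i, j)))\<^sup>2) = (\<Sum>k<n. (\<tau> k)\<^sup>2)"
    using mat_inner_svd_same[OF T T] by (simp add: mat_inner_self power2_eq_square)
  have TT: "(\<Sum>i<n. \<Sum>j<n. (cmod (T $$ (i, j)))\<^sup>2 * (t + (a i + b j) / 2)) = (\<Sum>k<n. (\<tau> k)\<^sup>2 * (t + d k))"
  proof -
    have "(\<Sum>i<n. \<Sum>j<n. (cmod (T $$ (i, j)))\<^sup>2 * (t + (a i + b j) / 2))
       = (\<Sum>i<n. \<Sum>j<n. t * (cmod (T $$ (i, j)))\<^sup>2 + (a i * (cmod (T $$ (i, j)))\<^sup>2 / 2 + b j * (cmod (T $$ (i, j)))\<^sup>2 / 2))"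
      by (intro sum.cong refl) (simp add: field_simps)
    also have "\<dots> = t * (\<Sum>i<n. \<Sum>j<n. (cmod (T $$ (i, j)))\<^sup>2)
         + ((\<Sum>i<n. \<Sum>j<n. a i * (cmod (T $$ (i, j)))\<^sup>2) / 2 + (\<Sum>i<n. \<Sum>j<n. b j * (cmod (T $$ (i, j)))\<^sup>2) / 2)"
      by (simp only: sum.distrib sum_distrib_left sum_divide_distrib)
    also have "\<dots> = (\<Sum>k<n. t * (\<tau> k)\<^sup>2 + ((\<tau> k)\<^sup>2 * (\<Sum>i<n. a i * (cmod (E $$ (i, k)))\<^sup>2) / 2
         + (\<tau> k)\<^sup>2 * (\<Sum>j<n. b j * (cmod (F $$ (j, k)))\<^sup>2) / 2))"
      unfolding row col tot by (simp only: sum.distrib sum_distrib_left[of t] sum_divide_distrib[of _ _ 2])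
    also have "\<dots> = (\<Sum>k<n. (\<tau> k)\<^sup>2 * (t + d k))"
      unfolding d_def by (intro sum.cong refl) (simp add: field_simps)
    finally show ?thesis .
  qed
  have point: "2 * Re (cnj (P $$ (i, j)) * T $$ (i, j)) - (cmod (T $$ (i, j)))\<^sup>2 * (t + (a i + b j) / 2)
      \<le> (cmod (P $$ (i, j)))\<^sup>2 / (t + (a i + b j) / 2)" if ij: "i < n" "j < n" for i j
  \<comment> \<open>If the denominator vanishes, the right side is 0 by \<open>x / 0 = 0\<close>,
    and \<open>zero\<close> makes the left side 0 as well.\<close>
  proof (cases "t + (a i + b j) / 2 = 0")
    case True
    then have "a i + b j = 0" using t ab(1)[of i] ab(2)[of j] by (simp add: add_nonneg_eq_0_iff)
    then show ?thesis using zero[OF ij] t ab(1)[of i] ab(2)[of j] by simp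
  next
    case False
    define c where "c = t + (a i + b j) / 2"
    have c: "c > 0" using False t ab(1)[of i] ab(2)[of j] unfolding c_def by (smt (verit) divide_nonneg_pos)
    have "Re (cnj (P $$ (i, j)) * T $$ (i, j)) \<le> cmod (P $$ (i, j)) * cmod (T $$ (i, j))"
      using complex_Re_le_cmod[of "cnj (P $$ (i, j)) * T $$ (i, j)"] by (simp add: norm_mult)
    moreover have "0 \<le> (cmod (P $$ (i, j)) - c * cmod (T $$ (i, j)))\<^sup>2 / c" using c by simp
    then have "2 * (cmod (P $$ (i, j)) * cmod (T $$ (i, j))) \<le> (cmod (P $$ (i, j)))\<^sup>2 / c + (cmod (T $$ (i, j)))\<^sup>2 * c"
      using c by (simp add: power2_eq_square field_simps)
    ultimately show ?thesis unfolding c_def[symmetric] by linarith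
  qed
  have "(\<Sum>k<n. (y k)\<^sup>2 / (t + d k)) = (\<Sum>k<n. 2 * (y k * \<tau> k) - (\<tau> k)\<^sup>2 * (t + d k))"
    by (intro sum.cong refl) (auto simp: \<tau>_def power2_eq_square)
  also have "\<dots> = 2 * mat_inner n P T - (\<Sum>i<n. \<Sum>j<n. (cmod (T $$ (i, j)))\<^sup>2 * (t + (a i + b j) / 2))"
    unfolding PT TT by (simp add: sum_subtractf sum_distrib_left)
  also have "\<dots> = (\<Sum>i<n. \<Sum>j<n. 2 * Re (cnj (P $$ (i, j)) * T $$ (i, j)) - (cmod (T $$ (i, j)))\<^sup>2 * (t + (a i + b j) / 2))"
    by (simp add: mat_inner_def sum_subtractf sum_distrib_left)
  also have "\<dots> \<le> (\<Sum>i<n. \<Sum>j<n. (cmod (P $$ (i, j)))\<^sup>2 / (t + (a i + b j) / 2))"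
    using point by (intro sum_mono) auto
  finally show ?thesis .
qed

text \<open>The resolvent comparison, turned into one for the power p - 2, replaces the double sum
  by the sum of y_k^2 d_k^(p-2). Hoelder's inequality bounds that sum below through the sum of
  y_k^p, and Jensen's inequality bounds the sum of d_k^p by the mean of the sums for
  \<open>a\<close> and \<open>b\<close>.\<close>

lemma schatten_lower_bound:
  fixes a b :: "nat \<Rightarrow> real"
  assumes p: "1 \<le> p" "p \<le> 2"
    and P: "is_svd n P E y F"
    and ab: "\<And>i. a i \<ge> 0" "\<And>i. b i \<ge> 0"
    and zero: "\<And>i j. i < n \<Longrightarrow> j < n \<Longrightarrow> a i + b j = 0 \<Longrightarrow> P $$ (i, j) = 0"
  shows "(\<Sum>k<n. y k powr p) powr (2 / p)
     \<le> (\<Sum>i<n. \<Sum>j<n. (cmod (P $$ (i, j)))\<^sup>2 * ((a i + b j) / 2) powr (p - 2))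
       * (((\<Sum>i<n. a i powr p) + (\<Sum>j<n. b j powr p)) / 2) powr ((2 - p) / p)"
proof -
  define d where "d k = ((\<Sum>i<n. a i * (cmod (E $$ (i, k)))\<^sup>2) + (\<Sum>j<n. b j * (cmod (F $$ (j, k)))\<^sup>2)) / 2" for k
  have E: "unitary_mat n E" "unitary_mat n F" and y: "\<And>i. y i \<ge> 0" using P by (auto simp: is_svd_def)
  have d0: "d k \<ge> 0" for k unfolding d_def using ab by (simp add: sum_nonneg)
  define w where "w = (\<lambda>(i, j). (cmod (P $$ (i, j)))\<^sup>2)"
  define s where "s = (\<lambda>(i, j). (a i + b j) / 2)"
  \<comment> \<open>\<open>resolvent_dominated_powr\<close> asks for positive arguments. The pairs
    outside \<open>I\<close> have weight 0 by \<open>zero\<close>, and the indices outside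
    \<open>J\<close> contribute nothing since y_k = 0.\<close>
  define I where "I = {x \<in> {..<n} \<times> {..<n}. s x > 0}"
  define J where "J = {k \<in> {..<n}. y k \<noteq> 0}"
  have fin: "finite I" "finite J" by (auto simp: I_def J_def)
  have s0: "s x \<ge> 0" for x using ab by (cases x) (simp add: s_def)
  have w0: "w x \<ge> 0" for x by (cases x) (simp add: w_def)
  have w_out: "w x = 0" if "x \<in> {..<n} \<times> {..<n} - I" for x
    using that zero s0[of x] by (cases x) (auto simp: I_def w_def s_def)
  have to_I: "(\<Sum>i<n. \<Sum>j<n. (cmod (P $$ (i, j)))\<^sup>2 * g ((a i + b j) / 2)) = (\<Sum>x\<in>I. w x * g (s x))" for g :: "real \<Rightarrow> real"
  proof -
    have "(\<Sum>i<n. \<Sum>j<n. (cmod (P $$ (i, j)))\<^sup>2 * g ((a i + b j) / 2)) = (\<Sum>x\<in>{..<n} \<times> {..<n}. w x * g (s x))"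
      unfolding sum.cartesian_product by (intro sum.cong refl) (auto simp: w_def s_def)
    also have "\<dots> = (\<Sum>x\<in>I. w x * g (s x))"
      using w_out by (intro sum.mono_neutral_right) (auto simp: I_def)
    finally show ?thesis .
  qed
  have to_J: "(\<Sum>k<n. (y k)\<^sup>2 * g k) = (\<Sum>k\<in>J. (y k)\<^sup>2 * g k)" for g
    by (intro sum.mono_neutral_right) (auto simp: J_def)
  have resolvent: "(\<Sum>k\<in>J. (y k)\<^sup>2 / (t + d k)) \<le> (\<Sum>x\<in>I. w x / (t + s x))" if t: "t \<ge> 0" for t
  proof -
    have "(\<Sum>k<n. (y k)\<^sup>2 / (t + d k)) \<le> (\<Sum>i<n. \<Sum>j<n. (cmod (P $$ (i, j)))\<^sup>2 / (t + (a i + b j) / 2))"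
      unfolding d_def using resolvent_compression[OF P ab zero t] .
    then show ?thesis
      using to_I[of "\<lambda>u. 1 / (t + u)"] to_J[of "\<lambda>k. 1 / (t + d k)"] by simp
  qed
  \<comment> \<open>If d_k = 0, then y_k^2 / t stays below \<open>C\<close> for all t > 0. The
    chosen \<open>t\<close> makes it equal to \<open>2 * (C + 1)\<close>.\<close>
  have d_pos: "d k > 0" if k: "k \<in> J" for k
  proof (rule ccontr)
    assume "\<not> d k > 0"
    then have dk: "d k = 0" using d0[of k] by simp
    define C where "C = (\<Sum>x\<in>I. w x / s x)"
    have C: "C \<ge> 0" unfolding C_def using s0 w0 by (intro sum_nonneg) auto
    have yk: "(y k)\<^sup>2 > 0" using k by (simp add: J_def)
    define t where "t = (y k)\<^sup>2 / (2 * (C + 1))"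
    have t: "t > 0" unfolding t_def using yk C by simp
    have "(y k)\<^sup>2 / t = (y k)\<^sup>2 / (t + d k)" using dk by simp
    also have "\<dots> \<le> (\<Sum>k\<in>J. (y k)\<^sup>2 / (t + d k))"
      using t d0 k fin by (intro member_le_sum) (auto intro!: divide_nonneg_nonneg add_nonneg_nonneg)
    also have "\<dots> \<le> (\<Sum>x\<in>I. w x / (t + s x))" using resolvent t by simp
    also have "\<dots> \<le> C" unfolding C_def using t w0
      by (intro sum_mono divide_left_mono mult_pos_pos) (auto simp: I_def)
    finally have "2 * (C + 1) \<le> C" using yk by (simp add: t_def)
    then show False using C by simp
  qed
  have "(\<Sum>k\<in>J. (y k)\<^sup>2 * d k powr (- (2 - p))) \<le> (\<Sum>x\<in>I. w x * s x powr (- (2 - p)))"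
  proof (rule resolvent_dominated_powr)
    \<comment> \<open>Both are the squared Hilbert-Schmidt norm of \<open>P\<close>.\<close>
    show "(\<Sum>k\<in>J. (y k)\<^sup>2) = sum w I"
      using to_I[of "\<lambda>_. 1"] to_J[of "\<lambda>_. 1"] mat_inner_svd_same[OF P P]
      by (simp add: mat_inner_self power2_eq_square)
  qed (use p fin w0 d_pos resolvent in \<open>auto simp: I_def\<close>)
  then have main: "(\<Sum>k\<in>J. (y k)\<^sup>2 * d k powr (p - 2)) \<le> (\<Sum>x\<in>I. w x * s x powr (p - 2))" by simp
  have "(\<Sum>k<n. y k powr p) = (\<Sum>k\<in>J. y k powr p)"
    by (intro sum.mono_neutral_right) (auto simp: J_def)
  moreover have "2 / p = 1 + (2 - p) / p" using p by (simp add: field_simps)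
  ultimately have "(\<Sum>k<n. y k powr p) powr (2 / p) = (\<Sum>k\<in>J. y k powr p) powr (1 + (2 - p) / p)" by simp
  also have "\<dots> \<le> (\<Sum>k\<in>J. (y k)\<^sup>2 * d k powr (p - 2)) * (\<Sum>k\<in>J. d k powr p) powr ((2 - p) / p)"
  proof (rule reverse_Hoelder_sum)
    \<comment> \<open>For g = (2-p)/p the powers of d_k cancel, and the pointwise hypothesis holds
      with equality.\<close>
    fix k assume k: "k \<in> J"
    have "(y k powr p) powr (1 + (2 - p) / p) = y k powr 2"
      using p by (simp add: powr_powr field_simps)
    moreover have "(d k powr p) powr ((2 - p) / p) = d k powr (2 - p)" using p by (simp add: powr_powr)
    moreover have "d k powr (p - 2) * d k powr (2 - p) = 1"
      using d_pos[OF k] by (simp flip: powr_add)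
    ultimately show "(y k powr p) powr (1 + (2 - p) / p) \<le> (y k)\<^sup>2 * d k powr (p - 2) * (d k powr p) powr ((2 - p) / p)"
      using y[of k] by (simp add: mult.assoc)
  qed (use fin p in auto)
  also have "\<dots> \<le> (\<Sum>x\<in>I. w x * s x powr (p - 2))
       * (((\<Sum>i<n. a i powr p) + (\<Sum>j<n. b j powr p)) / 2) powr ((2 - p) / p)"
  proof (intro mult_mono main powr_mono2)
    \<comment> \<open>The squared moduli of the entries of a unitary matrix are doubly stochastic:
      columns supply the Jensen weights, and rows collect the result.\<close>
    have jensen: "(\<Sum>k<n. (\<Sum>i<n. a i * (cmod (U $$ (i, k)))\<^sup>2) powr p) \<le> (\<Sum>i<n. a i powr p)"
      if a: "\<And>i. a i \<ge> 0" and U: "unitary_mat n U" for a :: "nat \<Rightarrow> real" and U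
    proof -
      have "(\<Sum>k<n. (\<Sum>i<n. a i * (cmod (U $$ (i, k)))\<^sup>2) powr p) \<le> (\<Sum>k<n. \<Sum>i<n. (cmod (U $$ (i, k)))\<^sup>2 * a i powr p)"
        using powr_jensen_sum[of p "{..<n}" "\<lambda>i. (cmod (U $$ (i, _)))\<^sup>2" a] a p unitary_mat_sum_cols[OF U]
        by (intro sum_mono) (simp add: mult.commute)
      also have "\<dots> = (\<Sum>i<n. a i powr p * (\<Sum>k<n. (cmod (U $$ (i, k)))\<^sup>2))"
        by (subst sum.swap) (simp add: sum_distrib_left mult.commute)
      finally show ?thesis using unitary_mat_sum_rows[OF U] by simp
    qed
    have half: "d k powr p \<le> ((\<Sum>i<n. a i * (cmod (E $$ (i, k)))\<^sup>2) powr p + (\<Sum>j<n. b j * (cmod (F $$ (j, k)))\<^sup>2) powr p) / 2" for k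
      using powr_jensen_sum[of p "{True, False}" "\<lambda>_. 1/2"
          "\<lambda>c. if c then \<Sum>i<n. a i * (cmod (E $$ (i, k)))\<^sup>2 else \<Sum>j<n. b j * (cmod (F $$ (j, k)))\<^sup>2"] ab p
      by (simp add: d_def sum_nonneg add_divide_distrib)
    have "(\<Sum>k\<in>J. d k powr p) \<le> (\<Sum>k<n. d k powr p)" by (intro sum_mono2) (auto simp: J_def)
    also have "\<dots> \<le> (\<Sum>k<n. ((\<Sum>i<n. a i * (cmod (E $$ (i, k)))\<^sup>2) powr p + (\<Sum>j<n. b j * (cmod (F $$ (j, k)))\<^sup>2) powr p) / 2)"
      using half by (rule sum_mono)
    also have "\<dots> \<le> ((\<Sum>i<n. a i powr p) + (\<Sum>j<n. b j powr p)) / 2"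
      using jensen[of a E] jensen[of b F] ab E by (simp add: sum.distrib flip: sum_divide_distrib)
    finally show "(\<Sum>k\<in>J. d k powr p) \<le> ((\<Sum>i<n. a i powr p) + (\<Sum>j<n. b j powr p)) / 2" .
  qed (use p w0 in \<open>auto intro!: sum_nonneg\<close>)
  finally show ?thesis unfolding to_I[of "\<lambda>u. u powr (p - 2)"] .
qed

section \<open>Convexity and monotonicity in singular bases\<close>

text \<open>This spreads single sums over singular values into double sums, which can be compared
  term by term with those of \<open>mat_inner_svd\<close>.\<close>

lemma sum_doubly_stochastic:
  fixes w :: "'a \<Rightarrow> 'b \<Rightarrow> real"
  assumes "\<And>l. l \<in> B \<Longrightarrow> (\<Sum>k\<in>A. w k l) = 1" "\<And>k. k \<in> A \<Longrightarrow> (\<Sum>l\<in>B. w k l) = 1"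
  shows "(\<Sum>k\<in>A. \<Sum>l\<in>B. w k l * (f l + g k)) = sum f B + sum g A"
proof -
  have "(\<Sum>k\<in>A. \<Sum>l\<in>B. w k l * (f l + g k)) = (\<Sum>k\<in>A. \<Sum>l\<in>B. w k l * f l) + (\<Sum>k\<in>A. \<Sum>l\<in>B. w k l * g k)"
    by (simp add: ring_distribs sum.distrib)
  also have "(\<Sum>k\<in>A. \<Sum>l\<in>B. w k l * f l) = (\<Sum>l\<in>B. (\<Sum>k\<in>A. w k l) * f l)"
    by (subst sum.swap) (simp add: sum_distrib_right)
  also have "(\<Sum>k\<in>A. \<Sum>l\<in>B. w k l * g k) = (\<Sum>k\<in>A. (\<Sum>l\<in>B. w k l) * g k)"
    by (simp add: sum_distrib_right)
  finally show ?thesis using assms by simp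
qed

lemma powr_pred_mult:
  fixes x p :: real
  assumes "x \<ge> 0"
  shows "x powr (p - 1) * x = x powr p"
  using assms by (cases "x = 0") (simp_all add: powr_mult_base mult.commute[of _ x])

text \<open>1/p times the gradient of \<open>schatten_power p\<close>, in terms of a decomposition.
  For p = 1 the convention \<open>0 powr 0 = 0\<close> makes it the partial isometry of the polar
  decomposition, a subgradient of the trace norm.\<close>

definition schatten_gradient :: "nat \<Rightarrow> real \<Rightarrow> complex mat \<Rightarrow> (nat \<Rightarrow> real) \<Rightarrow> complex mat \<Rightarrow> complex mat" where
  "schatten_gradient n p U s V = U * diagonal_of n (\<lambda>i. s i powr (p - 1)) * mat_adjoint V"

lemma is_svd_gradient:
  "is_svd n M U s V \<Longrightarrow> is_svd n (schatten_gradient n p U s V) U (\<lambda>i. s i powr (p - 1)) V"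
  by (simp add: is_svd_def schatten_gradient_def)

lemma Re_mult_cnj_le: "\<bar>Re (a * cnj b)\<bar> \<le> ((cmod a)\<^sup>2 + (cmod b)\<^sup>2) / 2"
proof -
  have "\<bar>Re (a * cnj b)\<bar> \<le> cmod a * cmod b" using abs_Re_le_cmod[of "a * cnj b"] by (simp add: norm_mult)
  moreover have "0 \<le> (cmod a - cmod b)\<^sup>2" by simp
  ultimately show ?thesis by (simp add: power2_eq_square algebra_simps)
qed

lemma mat_inner_diff_right:
  assumes "A \<in> carrier_mat n n" "B \<in> carrier_mat n n" "C \<in> carrier_mat n n"
  shows "mat_inner n A (B - C) = mat_inner n A B - mat_inner n A C"
  using assms by (simp add: mat_inner_def ring_distribs sum_subtractf)

text \<open>Averaging the squared moduli of both overlap matrices gives doubly stochastic weights.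
  By \<open>Re_mult_cnj_le\<close> they dominate the real overlaps that occur in inner
  products.\<close>

lemma unitary_weights:
  assumes "unitary_mat n \<alpha>" "unitary_mat n \<beta>"
  defines "w \<equiv> \<lambda>k l. ((cmod (\<alpha> $$ (k, l)))\<^sup>2 + (cmod (\<beta> $$ (k, l)))\<^sup>2) / 2"
  shows "l < n \<Longrightarrow> (\<Sum>k<n. w k l) = 1" "k < n \<Longrightarrow> (\<Sum>l<n. w k l) = 1"
  using assms(1,2) by (simp_all add: w_def sum.distrib unitary_mat_sum_cols unitary_mat_sum_rows flip: sum_divide_distrib)

text \<open>In the inner product of the gradient with \<open>Z\<close>, each overlap is bounded by
  its weight and \<open>powr_tangent\<close> is applied to each pair of singular values; double
  stochasticity sums the result.\<close>

lemma schatten_power_convex: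
  assumes p: "p \<ge> 1" and X: "is_svd n X U x V" and Z: "Z \<in> carrier_mat n n"
  shows "schatten_power p X + p * mat_inner n (schatten_gradient n p U x V) (Z - X) \<le> schatten_power p Z"
proof -
  obtain U' z V' where Z': "is_svd n Z U' z V'" using svd_exists[OF Z] by blast
  define G where "G = schatten_gradient n p U x V"
  have G: "is_svd n G U (\<lambda>i. x i powr (p - 1)) V" unfolding G_def using X by (rule is_svd_gradient)
  have nn: "\<And>i. x i \<ge> 0" "\<And>i. z i \<ge> 0" using X Z' by (auto simp: is_svd_def)
  define \<alpha> where "\<alpha> = mat_adjoint U * U'"
  define \<beta> where "\<beta> = mat_adjoint V * V'"
  have u: "unitary_mat n \<alpha>" "unitary_mat n \<beta>"
    unfolding \<alpha>_def \<beta>_def using X Z' by (auto simp: is_svd_def intro: unitary_mat_mult unitary_mat_adjoint)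
  define w where "w k l = ((cmod (\<alpha> $$ (k, l)))\<^sup>2 + (cmod (\<beta> $$ (k, l)))\<^sup>2) / 2" for k l
  have "p * mat_inner n G Z = (\<Sum>k<n. \<Sum>l<n. p * (x k powr (p - 1) * z l * Re (\<alpha> $$ (k, l) * cnj (\<beta> $$ (k, l)))))"
    unfolding mat_inner_svd[OF G Z'] \<alpha>_def \<beta>_def by (simp only: sum_distrib_left)
  also have "\<dots> \<le> (\<Sum>k<n. \<Sum>l<n. w k l * (z l powr p + (p - 1) * x k powr p))"
  proof (intro sum_mono)
    fix k l
    have tangent: "p * (x k powr (p - 1) * z l) \<le> z l powr p + (p - 1) * x k powr p"
      using powr_tangent[of "z l" "x k" p] powr_pred_mult[of "x k" p] nn p by (simp add: algebra_simps)
    have "Re (\<alpha> $$ (k, l) * cnj (\<beta> $$ (k, l))) \<le> w k l"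
      unfolding w_def using Re_mult_cnj_le abs_le_D1 by blast
    then have "(p * (x k powr (p - 1) * z l)) * Re (\<alpha> $$ (k, l) * cnj (\<beta> $$ (k, l))) \<le> (p * (x k powr (p - 1) * z l)) * w k l"
      using nn p by (intro mult_left_mono) auto
    also have "\<dots> \<le> (z l powr p + (p - 1) * x k powr p) * w k l"
      by (intro mult_right_mono tangent) (simp add: w_def)
    finally show "p * (x k powr (p - 1) * z l * Re (\<alpha> $$ (k, l) * cnj (\<beta> $$ (k, l)))) \<le> w k l * (z l powr p + (p - 1) * x k powr p)"
      by (simp add: mult_ac)
  qed
  also have "\<dots> = (\<Sum>l<n. z l powr p) + (\<Sum>k<n. (p - 1) * x k powr p)"
    unfolding w_def using unitary_weights[OF u] by (intro sum_doubly_stochastic) auto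
  also have "\<dots> = schatten_power p Z + (p - 1) * schatten_power p X"
    by (simp add: schatten_power_svd[OF X] schatten_power_svd[OF Z'] sum_distrib_left)
  finally have "p * mat_inner n G Z \<le> schatten_power p Z + (p - 1) * schatten_power p X" .
  moreover have "mat_inner n G X = schatten_power p X"
    using nn by (simp add: mat_inner_svd_same[OF G X] schatten_power_svd[OF X] powr_pred_mult)
  moreover have "mat_inner n G (Z - X) = mat_inner n G Z - mat_inner n G X"
    using is_svd_carrier[OF G] Z is_svd_carrier[OF X] by (intro mat_inner_diff_right)
  ultimately have "p * mat_inner n G (Z - X) = p * mat_inner n G Z - p * schatten_power p X"
    "p * mat_inner n G Z \<le> schatten_power p Z + (p - 1) * schatten_power p X"
    by (simp_all add: right_diff_distrib)
  then show ?thesis unfolding G_def by (simp add: left_diff_distrib)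
qed

text \<open>The left basis of X together with the right basis of Z turns the difference into
  overlaps weighted by single singular values.\<close>

lemma svd_difference_index:
  assumes X: "is_svd n X U x V" and Z: "is_svd n Z U' z V'" and kl: "k < n" "l < n"
  shows "(mat_adjoint U * (Z - X) * V') $$ (k, l)
     = (mat_adjoint U * U') $$ (k, l) * z l - x k * (mat_adjoint V * V') $$ (k, l)"
proof -
  have u: "unitary_mat n U" "unitary_mat n V" "unitary_mat n U'" "unitary_mat n V'"
    using X Z by (auto simp: is_svd_def)
  note c = unitary_matD(1)[OF u(1)] unitary_matD(1)[OF u(2)] unitary_matD(1)[OF u(3)] unitary_matD(1)[OF u(4)]
  note cX = is_svd_carrier[OF X] and cZ = is_svd_carrier[OF Z]
  have "mat_adjoint U * (Z - X) * V' = mat_adjoint U * Z * V' - mat_adjoint U * X * V'"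
    using c cX cZ by (simp add: mult_minus_distrib_mat[of _ n n _ n] minus_mult_distrib_mat[of _ n n _ _ n] mult_carrier_mat[of _ n n])
  also have "mat_adjoint U * Z * V' = mat_adjoint U * U' * diagonal_of n z * (mat_adjoint V' * V')"
    using c Z unfolding is_svd_def
    by (simp add: assoc_mult_mat[of _ n n _ n _ n] mult_carrier_mat[of _ n n])
  also have "\<dots> = mat_adjoint U * U' * diagonal_of n z"
    unfolding unitary_matD(2)[OF u(4)] using c by (simp add: right_mult_one_mat[of _ n n] mult_carrier_mat[of _ n n])
  also have "mat_adjoint U * X * V' = (mat_adjoint U * U) * (diagonal_of n x * (mat_adjoint V * V'))"
    using c X unfolding is_svd_def
    by (simp add: assoc_mult_mat[of _ n n _ n _ n] mult_carrier_mat[of _ n n])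
  also have "\<dots> = diagonal_of n x * (mat_adjoint V * V')"
    unfolding unitary_matD(2)[OF u(1)] using c by (simp add: left_mult_one_mat[of _ n n] mult_carrier_mat[of _ n n])
  finally have "(mat_adjoint U * (Z - X) * V') $$ (k, l)
      = (mat_adjoint U * U' * diagonal_of n z) $$ (k, l) - (diagonal_of n x * (mat_adjoint V * V')) $$ (k, l)"
    using kl c by (simp del: index_mult_mat(1) add: diagonal_of_def)
  then show ?thesis
    using kl c by (simp del: index_mult_mat(1) add: mult_diagonal_of_index[of _ n] diagonal_of_mult_index[of _ n n] mult_carrier_mat[of _ n n])
qed

lemma cmod_scaled_diff_squared:
  fixes a b :: complex and z x :: real
  shows "(cmod (a * z - x * b))\<^sup>2 = z\<^sup>2 * (cmod a)\<^sup>2 + x\<^sup>2 * (cmod b)\<^sup>2 - 2 * z * x * Re (a * cnj b)"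
  unfolding cmod_power2 by (simp add: power2_eq_square algebra_simps)

text \<open>Both sides are affine in \<open>r\<close>, so it suffices to look at r = w and r = -w.
  There the claim is \<open>powr_diff_midpoint\<close> and \<open>powr_sum_midpoint\<close> with
  exponent p - 1; the proof takes the convex combination of the two.\<close>

lemma gradient_pair_bound:
  fixes x z w r p :: real
  assumes nn: "x \<ge> 0" "z \<ge> 0" and p: "1 < p" "p \<le> 2" and r: "\<bar>r\<bar> \<le> w"
  shows "(p - 1) * ((x + z) / 2) powr (p - 2) * (w * (z\<^sup>2 + x\<^sup>2) - 2 * z * x * r)
     \<le> w * (z powr p + x powr p) - (x powr (p - 1) * z + x * z powr (p - 1)) * r"
proof -
  define S where "S = ((x + z) / 2) powr (p - 2)"
  have 1: "(p - 1) * (z - x)\<^sup>2 * S \<le> (z - x) * (z powr (p - 1) - x powr (p - 1))"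
    using powr_diff_midpoint[of z x "p - 1"] nn p by (simp add: S_def add.commute)
  have 2: "(p - 1) * (z + x)\<^sup>2 * S \<le> (z + x) * (z powr (p - 1) + x powr (p - 1))"
    using powr_sum_midpoint[of z x "p - 1"] nn p by (simp add: S_def add.commute)
  have "(p - 1) * S * (w * (z\<^sup>2 + x\<^sup>2) - 2 * z * x * r)
     = (w + r) / 2 * ((p - 1) * (z - x)\<^sup>2 * S) + (w - r) / 2 * ((p - 1) * (z + x)\<^sup>2 * S)"
    by (simp add: power2_eq_square field_simps)
  also have "\<dots> \<le> (w + r) / 2 * ((z - x) * (z powr (p - 1) - x powr (p - 1)))
     + (w - r) / 2 * ((z + x) * (z powr (p - 1) + x powr (p - 1)))"
    using r by (intro add_mono mult_left_mono 1 2) auto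
  also have "\<dots> = w * (z powr (p - 1) * z + x powr (p - 1) * x) - (x powr (p - 1) * z + x * z powr (p - 1)) * r"
    by (simp add: field_simps)
  finally show ?thesis using nn by (simp add: S_def powr_pred_mult)
qed

text \<open>\<open>P\<close> and \<open>Q\<close> represent Z - X and its adjoint in mixed singular
  bases, so both have the singular values of Z - X and \<open>schatten_lower_bound\<close> applies
  to each. The mean of the two bounds is compared with the inner product pair by pair, by
  \<open>gradient_pair_bound\<close>.\<close>

lemma schatten_gradient_monotone:
  assumes p: "1 < p" "p \<le> 2" and X: "is_svd n X U x V" and Z: "is_svd n Z U' z V'"
  shows "(p - 1) * schatten_power p (Z - X) powr (2 / p)
     \<le> mat_inner n (schatten_gradient n p U' z V' - schatten_gradient n p U x V) (Z - X)
       * ((schatten_power p X + schatten_power p Z) / 2) powr ((2 - p) / p)"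
proof -
  define GX where "GX = schatten_gradient n p U x V"
  define GZ where "GZ = schatten_gradient n p U' z V'"
  have GX: "is_svd n GX U (\<lambda>i. x i powr (p - 1)) V" unfolding GX_def using X by (rule is_svd_gradient)
  have GZ: "is_svd n GZ U' (\<lambda>i. z i powr (p - 1)) V'" unfolding GZ_def using Z by (rule is_svd_gradient)
  note carrier = is_svd_carrier[OF X] is_svd_carrier[OF Z] is_svd_carrier[OF GX] is_svd_carrier[OF GZ]
  have nn: "\<And>i. x i \<ge> 0" "\<And>i. z i \<ge> 0" using X Z by (auto simp: is_svd_def)
  have uu: "unitary_mat n U" "unitary_mat n V" "unitary_mat n U'" "unitary_mat n V'"
    using X Z by (auto simp: is_svd_def)
  define \<alpha> where "\<alpha> = mat_adjoint U * U'"
  define \<beta> where "\<beta> = mat_adjoint V * V'"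
  have u: "unitary_mat n \<alpha>" "unitary_mat n \<beta>"
    unfolding \<alpha>_def \<beta>_def using uu by (auto intro: unitary_mat_mult unitary_mat_adjoint)
  define w where "w k l = ((cmod (\<alpha> $$ (k, l)))\<^sup>2 + (cmod (\<beta> $$ (k, l)))\<^sup>2) / 2" for k l
  define r where "r k l = Re (\<alpha> $$ (k, l) * cnj (\<beta> $$ (k, l)))" for k l
  define S where "S k l = ((x k + z l) / 2) powr (p - 2)" for k l
  define q where "q = ((schatten_power p X + schatten_power p Z) / 2) powr ((2 - p) / p)"
  define P where "P = mat_adjoint U * (Z - X) * V'"
  \<comment> \<open>In the squared modulus of an entry of \<open>P\<close>, z^2 is weighted by
    \<alpha> alone and x^2 by \<beta> alone. \<open>Q\<close> exchanges the two, and the mean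
    carries the symmetric weight \<open>w\<close> of the inner product.\<close>
  define Q where "Q = mat_adjoint V * mat_adjoint (Z - X) * U'"
  obtain E y F where D: "is_svd n (Z - X) E y F" using svd_exists[OF minus_carrier_mat[OF carrier(1), of Z]] by blast
  have svdP: "is_svd n P (mat_adjoint U * E) y (mat_adjoint V' * F)"
    unfolding P_def using is_svd_unitary_mult[OF D unitary_mat_adjoint[OF uu(1)] unitary_mat_adjoint[OF uu(4)]] by simp
  have svdQ: "is_svd n Q (mat_adjoint V * F) y (mat_adjoint U' * E)"
    unfolding Q_def using is_svd_unitary_mult[OF is_svd_adjoint[OF D] unitary_mat_adjoint[OF uu(2)] unitary_mat_adjoint[OF uu(3)]] by simp
  have P_index: "P $$ (k, l) = \<alpha> $$ (k, l) * z l - x k * \<beta> $$ (k, l)" if "k < n" "l < n" for k l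
    unfolding P_def \<alpha>_def \<beta>_def using svd_difference_index[OF X Z that] .
  have adj: "mat_adjoint (Z - X) = mat_adjoint Z - mat_adjoint X"
    using carrier by (intro eq_matI) auto
  have Q_index: "Q $$ (k, l) = \<beta> $$ (k, l) * z l - x k * \<alpha> $$ (k, l)" if "k < n" "l < n" for k l
    unfolding Q_def \<alpha>_def \<beta>_def adj using svd_difference_index[OF is_svd_adjoint[OF X] is_svd_adjoint[OF Z] that] .
  have zero: "P $$ (k, l) = 0" "Q $$ (k, l) = 0" if "k < n" "l < n" "x k + z l = 0" for k l
    using that nn(1)[of k] nn(2)[of l] by (simp_all add: P_index Q_index add_nonneg_eq_0_iff)
  have boundP: "schatten_power p (Z - X) powr (2 / p) \<le> (\<Sum>k<n. \<Sum>l<n. (cmod (P $$ (k, l)))\<^sup>2 * S k l) * q"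
    using schatten_lower_bound[OF _ p(2) svdP nn zero(1)] p
    by (simp add: S_def q_def schatten_power_svd[OF D] schatten_power_svd[OF X] schatten_power_svd[OF Z])
  have boundQ: "schatten_power p (Z - X) powr (2 / p) \<le> (\<Sum>k<n. \<Sum>l<n. (cmod (Q $$ (k, l)))\<^sup>2 * S k l) * q"
    using schatten_lower_bound[OF _ p(2) svdQ nn zero(2)] p
    by (simp add: S_def q_def schatten_power_svd[OF D] schatten_power_svd[OF X] schatten_power_svd[OF Z])
  \<comment> \<open>The last term has \<open>X\<close> first, so that in both mixed terms
    \<open>k\<close> counts the singular values of X and \<open>l\<close> those of Z, with the same
    overlaps.\<close>
  have "mat_inner n (GZ - GX) (Z - X) = mat_inner n GZ Z + mat_inner n GX X - mat_inner n GX Z - mat_inner n X GZ"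
  proof -
    have "mat_inner n (GZ - GX) (Z - X) = mat_inner n (GZ - GX) Z - mat_inner n (GZ - GX) X"
      using carrier by (intro mat_inner_diff_right) auto
    also have "mat_inner n (GZ - GX) Z = mat_inner n Z GZ - mat_inner n Z GX"
      unfolding mat_inner_commute[of n _ Z] using carrier by (intro mat_inner_diff_right) auto
    also have "mat_inner n (GZ - GX) X = mat_inner n X GZ - mat_inner n X GX"
      unfolding mat_inner_commute[of n _ X] using carrier by (intro mat_inner_diff_right) auto
    finally show ?thesis
      unfolding mat_inner_commute[of n Z] mat_inner_commute[of n X GX] by simp
  qed
  also have "\<dots> = ((\<Sum>l<n. z l powr p) + (\<Sum>k<n. x k powr p))
     - (\<Sum>k<n. \<Sum>l<n. (x k powr (p - 1) * z l + x k * z l powr (p - 1)) * r k l)"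
    using nn by (simp add: mat_inner_svd_same[OF GZ Z] mat_inner_svd_same[OF GX X] mat_inner_svd[OF GX Z] mat_inner_svd[OF X GZ]
        powr_pred_mult r_def \<alpha>_def \<beta>_def ring_distribs sum.distrib del: index_mult_mat(1))
  also have "(\<Sum>l<n. z l powr p) + (\<Sum>k<n. x k powr p) = (\<Sum>k<n. \<Sum>l<n. w k l * (z l powr p + x k powr p))"
    unfolding w_def using unitary_weights[OF u] by (intro sum_doubly_stochastic[symmetric]) auto
  finally have inner: "mat_inner n (GZ - GX) (Z - X) = (\<Sum>k<n. \<Sum>l<n. w k l * (z l powr p + x k powr p)
      - (x k powr (p - 1) * z l + x k * z l powr (p - 1)) * r k l)"
    by (simp add: sum_subtractf)
  have PQ: "((cmod (P $$ (k, l)))\<^sup>2 + (cmod (Q $$ (k, l)))\<^sup>2) / 2 = w k l * ((z l)\<^sup>2 + (x k)\<^sup>2) - 2 * z l * x k * r k l"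
    if "k < n" "l < n" for k l
  proof -
    have "Re (\<beta> $$ (k, l) * cnj (\<alpha> $$ (k, l))) = r k l" by (simp add: r_def)
    then show ?thesis
      unfolding P_index[OF that] Q_index[OF that] cmod_scaled_diff_squared
      by (simp add: w_def r_def[symmetric] field_simps)
  qed
  have "(p - 1) * schatten_power p (Z - X) powr (2 / p)
     \<le> (p - 1) * (((\<Sum>k<n. \<Sum>l<n. (cmod (P $$ (k, l)))\<^sup>2 * S k l) * q + (\<Sum>k<n. \<Sum>l<n. (cmod (Q $$ (k, l)))\<^sup>2 * S k l) * q) / 2)"
    using boundP boundQ p by (intro mult_left_mono) auto
  also have "\<dots> = (\<Sum>k<n. \<Sum>l<n. (p - 1) * S k l * (((cmod (P $$ (k, l)))\<^sup>2 + (cmod (Q $$ (k, l)))\<^sup>2) / 2)) * q"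
  proof -
    have "(\<Sum>k<n. \<Sum>l<n. (p - 1) * S k l * (((cmod (P $$ (k, l)))\<^sup>2 + (cmod (Q $$ (k, l)))\<^sup>2) / 2))
       = (\<Sum>k<n. \<Sum>l<n. (p - 1) / 2 * ((cmod (P $$ (k, l)))\<^sup>2 * S k l) + (p - 1) / 2 * ((cmod (Q $$ (k, l)))\<^sup>2 * S k l))"
      by (intro sum.cong refl) (simp add: field_simps)
    also have "\<dots> = (p - 1) / 2 * (\<Sum>k<n. \<Sum>l<n. (cmod (P $$ (k, l)))\<^sup>2 * S k l)
       + (p - 1) / 2 * (\<Sum>k<n. \<Sum>l<n. (cmod (Q $$ (k, l)))\<^sup>2 * S k l)"
      by (simp only: sum.distrib sum_distrib_left)
    finally have eq: "(\<Sum>k<n. \<Sum>l<n. (p - 1) * S k l * (((cmod (P $$ (k, l)))\<^sup>2 + (cmod (Q $$ (k, l)))\<^sup>2) / 2))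
       = (p - 1) / 2 * (\<Sum>k<n. \<Sum>l<n. (cmod (P $$ (k, l)))\<^sup>2 * S k l)
       + (p - 1) / 2 * (\<Sum>k<n. \<Sum>l<n. (cmod (Q $$ (k, l)))\<^sup>2 * S k l)" .
    show ?thesis unfolding eq by (simp add: algebra_simps add_divide_distrib diff_divide_distrib)
  qed
  also have "\<dots> \<le> mat_inner n (GZ - GX) (Z - X) * q"
    unfolding inner
  proof (intro mult_right_mono sum_mono)
    fix k l assume "k \<in> {..<n}" "l \<in> {..<n}"
    moreover have "\<bar>r k l\<bar> \<le> w k l" unfolding r_def w_def by (rule Re_mult_cnj_le)
    ultimately show "(p - 1) * S k l * (((cmod (P $$ (k, l)))\<^sup>2 + (cmod (Q $$ (k, l)))\<^sup>2) / 2)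
      \<le> w k l * (z l powr p + x k powr p) - (x k powr (p - 1) * z l + x k * z l powr (p - 1)) * r k l"
      using gradient_pair_bound[OF nn(1)[of k] nn(2)[of l] p] by (simp add: PQ S_def)
  qed (simp add: q_def)
  finally show ?thesis unfolding GX_def GZ_def q_def .
qed

section \<open>Perturbations with mean zero\<close>

lemma schatten_power_nonneg: "schatten_power p M \<ge> 0"
proof -
  have "0 \<le> (\<Sum>x\<in>#S. x powr p)" for S :: "real multiset" by (induction S) auto
  then show ?thesis by (simp add: schatten_power_def)
qed

lemma mat_inner_diff_left:
  assumes "A \<in> carrier_mat n n" "B \<in> carrier_mat n n" "C \<in> carrier_mat n n"
  shows "mat_inner n (A - B) C = mat_inner n A C - mat_inner n B C"
  using mat_inner_diff_right[OF assms(3,1,2)] by (simp add: mat_inner_commute[of n C])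

lemma mat_inner_scale:
  assumes "\<And>i j. i < n \<Longrightarrow> j < n \<Longrightarrow> B $$ (i, j) = complex_of_real c * D $$ (i, j)"
  shows "mat_inner n A B = c * mat_inner n A D"
proof -
  have "(\<Sum>i<n. \<Sum>j<n. cnj (A $$ (i, j)) * B $$ (i, j)) = complex_of_real c * (\<Sum>i<n. \<Sum>j<n. cnj (A $$ (i, j)) * D $$ (i, j))"
    unfolding sum_distrib_left using assms by (intro sum.cong refl) (simp add: mult_ac)
  then show ?thesis unfolding mat_inner_def by simp
qed

lemma mat_inner_diff_swap:
  assumes "X \<in> carrier_mat n n" "Z \<in> carrier_mat n n"
  shows "mat_inner n A (X - Z) = - mat_inner n A (Z - X)"
  using mat_inner_scale[of n "X - Z" "-1" "Z - X" A] assms by simp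

text \<open>The phase of \<open>c\<close> is absorbed into the left factor; for c = 0 the phase is
  taken to be 1.\<close>

lemma is_svd_smult:
  assumes M: "is_svd n M U s V"
  obtains U' where "is_svd n (c \<cdot>\<^sub>m M) U' (\<lambda>i. cmod c * s i) V"
proof -
  define e where "e = (if c = 0 then 1 else sgn c)"
  have "cmod e = 1" by (simp add: e_def norm_sgn del: sgn_eq)
  moreover have "c = e * cmod c" by (simp add: e_def sgn_eq)
  ultimately have e: "cmod e = 1" "c = e * cmod c" by blast+
  have U: "unitary_mat n U" and V: "unitary_mat n V" and s: "\<And>i. 0 \<le> s i" using M by (auto simp: is_svd_def)
  note Uc = unitary_matD(1)[OF U]
  have ee: "cnj e * e = 1" using e(1) by (simp add: cnj_mult_self)
  have "mat_adjoint (e \<cdot>\<^sub>m U) * (e \<cdot>\<^sub>m U) = 1\<^sub>m n"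
  proof (rule eq_matI)
    fix i j assume "i < dim_row (1\<^sub>m n :: complex mat)" "j < dim_col (1\<^sub>m n :: complex mat)"
    then have ij: "i < n" "j < n" by auto
    have "(mat_adjoint (e \<cdot>\<^sub>m U) * (e \<cdot>\<^sub>m U)) $$ (i, j) = (\<Sum>k<n. cnj ((e \<cdot>\<^sub>m U) $$ (k, i)) * (e \<cdot>\<^sub>m U) $$ (k, j))"
      using ij Uc by (intro adjoint_mult_index) auto
    also have "\<dots> = (\<Sum>k<n. (cnj e * e) * (cnj (U $$ (k, i)) * U $$ (k, j)))"
      using ij Uc by (intro sum.cong) auto
    also have "\<dots> = (if i = j then 1 else 0)"
      unfolding ee by (simp add: unitary_mat_cols[OF U ij])
    finally show "(mat_adjoint (e \<cdot>\<^sub>m U) * (e \<cdot>\<^sub>m U)) $$ (i, j) = 1\<^sub>m n $$ (i, j)" using ij by simp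
  qed (use Uc in auto)
  then have U': "unitary_mat n (e \<cdot>\<^sub>m U)" using Uc by (simp add: unitary_mat_def)
  have "is_svd n (c \<cdot>\<^sub>m M) (e \<cdot>\<^sub>m U) (\<lambda>i. cmod c * s i) V"
  proof (rule is_svdI)
    fix i j assume ij: "i < n" "j < n"
    have "(c \<cdot>\<^sub>m M) $$ (i, j) = (e * cmod c) * (\<Sum>k<n. U $$ (i, k) * s k * cnj (V $$ (j, k)))"
      using is_svd_carrier[OF M] ij is_svd_index[OF M ij] e(2) by simp
    then show "(c \<cdot>\<^sub>m M) $$ (i, j) = (\<Sum>k<n. (e \<cdot>\<^sub>m U) $$ (i, k) * complex_of_real (cmod c * s k) * cnj (V $$ (j, k)))"
      using ij Uc by (simp add: sum_distrib_left mult_ac)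
  qed (use U' V s is_svd_carrier[OF M] in auto)
  then show thesis using that by blast
qed

lemma schatten_power_smult:
  assumes "M \<in> carrier_mat n n"
  shows "schatten_power p (c \<cdot>\<^sub>m M) = cmod c powr p * schatten_power p M"
proof -
  obtain U s V where M: "is_svd n M U s V" using svd_exists[OF assms] by blast
  then have s: "\<And>i. 0 \<le> s i" by (simp add: is_svd_def)
  obtain U' where "is_svd n (c \<cdot>\<^sub>m M) U' (\<lambda>i. cmod c * s i) V" using is_svd_smult[OF M] by blast
  then show ?thesis using s
    by (simp add: schatten_power_svd schatten_power_svd[OF M] powr_mult sum_distrib_left)
qed

text \<open>Choosing one decomposition for every matrix makes the gradient a function of the matrix
  alone, so that it can be evaluated along a line.\<close>

lemma schatten_gradient_exists:
  fixes p :: real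
  assumes p: "1 \<le> p" "p \<le> 2"
  obtains G where "\<And>X. X \<in> carrier_mat n n \<Longrightarrow> G X \<in> carrier_mat n n"
    "\<And>X Z. X \<in> carrier_mat n n \<Longrightarrow> Z \<in> carrier_mat n n \<Longrightarrow>
        schatten_power p X + p * mat_inner n (G X) (Z - X) \<le> schatten_power p Z"
    "\<And>X Z. X \<in> carrier_mat n n \<Longrightarrow> Z \<in> carrier_mat n n \<Longrightarrow>
        (p - 1) * schatten_power p (Z - X) powr (2 / p)
          \<le> mat_inner n (G Z - G X) (Z - X) * ((schatten_power p X + schatten_power p Z) / 2) powr ((2 - p) / p)"
proof -
  have "\<forall>X. \<exists>D. X \<in> carrier_mat n n \<longrightarrow> is_svd n X (fst D) (fst (snd D)) (snd (snd D))"
  proof (intro allI)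
    fix X :: "complex mat"
    show "\<exists>D. X \<in> carrier_mat n n \<longrightarrow> is_svd n X (fst D) (fst (snd D)) (snd (snd D))"
      using svd_exists[of X n] by simp
  qed
  then obtain D where D: "\<And>X. X \<in> carrier_mat n n \<Longrightarrow> is_svd n X (fst (D X)) (fst (snd (D X))) (snd (snd (D X)))"
    unfolding choice_iff by blast
  define G where "G X = schatten_gradient n p (fst (D X)) (fst (snd (D X))) (snd (snd (D X)))" for X
  have carrier: "G X \<in> carrier_mat n n" if "X \<in> carrier_mat n n" for X
    unfolding G_def using is_svd_gradient[OF D[OF that]] by (rule is_svd_carrier)
  have convex: "schatten_power p X + p * mat_inner n (G X) (Z - X) \<le> schatten_power p Z"
    if "X \<in> carrier_mat n n" "Z \<in> carrier_mat n n" for X Z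
    unfolding G_def using that p by (intro schatten_power_convex D)
  have "(p - 1) * schatten_power p (Z - X) powr (2 / p)
      \<le> mat_inner n (G Z - G X) (Z - X) * ((schatten_power p X + schatten_power p Z) / 2) powr ((2 - p) / p)"
    if XZ: "X \<in> carrier_mat n n" "Z \<in> carrier_mat n n" for X Z
  proof (cases "p = 1")
    case False
    then show ?thesis unfolding G_def using XZ p by (intro schatten_gradient_monotone D) auto
  next
    \<comment> \<open>For p = 1 the left side is 0. The inner product is nonnegative because the
      convexity inequalities at X and at Z add up to monotonicity.\<close>
    case True
    have "mat_inner n (G Z) (X - Z) = - mat_inner n (G Z) (Z - X)"
      using XZ by (intro mat_inner_diff_swap)
    moreover have "mat_inner n (G Z - G X) (Z - X) = mat_inner n (G Z) (Z - X) - mat_inner n (G X) (Z - X)"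
      by (rule mat_inner_diff_left[OF carrier[OF XZ(2)] carrier[OF XZ(1)] minus_carrier_mat[OF XZ(1)]])
    ultimately have "0 \<le> mat_inner n (G Z - G X) (Z - X)"
      using convex[OF XZ] convex[OF XZ(2,1)] True by simp
    then show ?thesis using True by simp
  qed
  then show thesis using that carrier convex by blast
qed

text \<open>A Riemann sum of 2 c s with left endpoints on a uniform partition into
  \<open>Suc N\<close> steps takes the place of the integral. It gives c (1 - 1/(N+1)), which tends
  to c.\<close>

lemma quadratic_growth:
  fixes \<phi> :: "real \<Rightarrow> real"
  assumes step: "\<And>s t. 0 \<le> s \<Longrightarrow> s < t \<Longrightarrow> t \<le> 1 \<Longrightarrow> \<phi> s + 2 * c * (t - s) * s \<le> \<phi> t"
  shows "\<phi> 0 + c \<le> \<phi> 1"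
proof -
  have "\<phi> 0 + c * (1 - 1 / real (Suc N)) \<le> \<phi> 1" for N
  proof -
    define M where "M = real (Suc N)"
    have M: "M > 0" by (simp add: M_def)
    have "\<phi> 0 + c * (real k * (real k - 1)) / M\<^sup>2 \<le> \<phi> (real k / M)" if "k \<le> Suc N" for k
      using that
    proof (induction k)
      case (Suc k)
      have "\<phi> (real k / M) + 2 * c * (real (Suc k) / M - real k / M) * (real k / M) \<le> \<phi> (real (Suc k) / M)"
        using M Suc.prems by (intro step) (auto simp: divide_strict_right_mono M_def)
      moreover have "2 * c * (real (Suc k) / M - real k / M) * (real k / M)
          = c * (real (Suc k) * (real (Suc k) - 1)) / M\<^sup>2 - c * (real k * (real k - 1)) / M\<^sup>2"
        using M by (simp add: field_simps power2_eq_square)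
      ultimately show ?case using Suc by simp
    qed simp
    from this[of "Suc N"] have "\<phi> 0 + c * (M * (M - 1)) / M\<^sup>2 \<le> \<phi> 1"
      using M unfolding M_def[symmetric] by simp
    moreover have "c * (M * (M - 1)) / M\<^sup>2 = c * (1 - 1 / M)"
      using M by (simp add: field_simps power2_eq_square)
    ultimately show ?thesis by (simp add: M_def)
  qed
  moreover have "(\<lambda>N. \<phi> 0 + c * (1 - 1 / real (Suc N))) \<longlonglongrightarrow> \<phi> 0 + c * (1 - 0)"
    by (intro tendsto_intros lim_const_over_n LIMSEQ_Suc)
  ultimately show ?thesis by (intro LIMSEQ_le_const2[of _ "\<phi> 0 + c"]) auto
qed

text \<open>The mean power \<open>H\<close> is followed along m + s d_k. Formally H' = p B, so
  H^(2/p) has derivative 2 B H^g, which \<open>B_bound\<close> puts above 2 (p-1) s N;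
  \<open>quadratic_growth\<close> integrates this. As the d_k have mean zero, the terms with the
  gradient at \<open>m\<close> cancel.\<close>

lemma schatten_power_average:
  fixes p :: real and m :: "complex mat" and d :: "nat \<Rightarrow> complex mat"
  assumes p: "1 \<le> p" "p \<le> 2" and r: "r > 0"
    and m: "m \<in> carrier_mat n n" and d: "\<And>k. k < r \<Longrightarrow> d k \<in> carrier_mat n n"
    and mean: "\<And>i j. i < n \<Longrightarrow> j < n \<Longrightarrow> (\<Sum>k<r. d k $$ (i, j)) = 0"
  shows "schatten_power p m powr (2 / p) + (p - 1) * ((\<Sum>k<r. schatten_power p (d k)) / r) powr (2 / p)
    \<le> ((\<Sum>k<r. schatten_power p (m + d k)) / r) powr (2 / p)"
proof -
  obtain G where G: "\<And>X. X \<in> carrier_mat n n \<Longrightarrow> G X \<in> carrier_mat n n"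
    and convex: "\<And>X Z. X \<in> carrier_mat n n \<Longrightarrow> Z \<in> carrier_mat n n \<Longrightarrow>
        schatten_power p X + p * mat_inner n (G X) (Z - X) \<le> schatten_power p Z"
    and monotone: "\<And>X Z. X \<in> carrier_mat n n \<Longrightarrow> Z \<in> carrier_mat n n \<Longrightarrow>
        (p - 1) * schatten_power p (Z - X) powr (2 / p)
          \<le> mat_inner n (G Z - G X) (Z - X) * ((schatten_power p X + schatten_power p Z) / 2) powr ((2 - p) / p)"
    using schatten_gradient_exists[OF p] by blast
  define X where "X s k = m + complex_of_real s \<cdot>\<^sub>m d k" for s k
  define H where "H s = (\<Sum>k<r. schatten_power p (X s k)) / r" for s
  define B where "B s = (\<Sum>k<r. mat_inner n (G (X s k)) (d k)) / r" for s
  define N where "N = ((\<Sum>k<r. schatten_power p (d k)) / r) powr (2 / p)"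
  define g where "g = (2 - p) / p"
  have g: "1 + g = 2 / p" "g \<ge> 0" using p by (auto simp: g_def field_simps)
  have X: "X s k \<in> carrier_mat n n" if "k < r" for s k using m d[OF that] by (simp add: X_def)
  have inner_step: "mat_inner n C (X t k - X s k) = (t - s) * mat_inner n C (d k)" if "k < r" for C s t k
    using m d[OF that] by (intro mat_inner_scale) (auto simp: X_def algebra_simps)
  have X0: "X 0 k = m" if "k < r" for k using m d[OF that] by (auto simp: X_def intro!: eq_matI)
  have centered: "(\<Sum>k<r. mat_inner n C (d k)) = 0" for C
  proof -
    have "(\<Sum>k<r. mat_inner n C (d k)) = Re (\<Sum>i<n. \<Sum>j<n. cnj (C $$ (i, j)) * (\<Sum>k<r. d k $$ (i, j)))"
      unfolding mat_inner_def Re_sum[symmetric] sum_distrib_left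
      by (subst sum.swap, subst (2) sum.swap, rule refl)
    then show ?thesis using mean by simp
  qed
  have H0: "H 0 = schatten_power p m" using r X0 by (simp add: H_def)
  have H_nonneg: "H s \<ge> 0" for s by (simp add: H_def sum_nonneg schatten_power_nonneg)
  have H_step: "H s + p * (t - s) * B s \<le> H t" for s t
  proof -
    have "(\<Sum>k<r. schatten_power p (X s k) + p * ((t - s) * mat_inner n (G (X s k)) (d k))) \<le> (\<Sum>k<r. schatten_power p (X t k))"
    proof (intro sum_mono)
      fix k assume "k \<in> {..<r}"
      then have k: "k < r" by simp
      show "schatten_power p (X s k) + p * ((t - s) * mat_inner n (G (X s k)) (d k)) \<le> schatten_power p (X t k)"
        using convex[OF X[OF k] X[OF k], of s t] by (simp add: inner_step[OF k])
    qed
    then have "((\<Sum>k<r. schatten_power p (X s k)) + p * ((t - s) * (\<Sum>k<r. mat_inner n (G (X s k)) (d k)))) / r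
      \<le> (\<Sum>k<r. schatten_power p (X t k)) / r"
      by (intro divide_right_mono) (simp_all add: sum.distrib sum_distrib_left)
    then show ?thesis by (simp add: H_def B_def add_divide_distrib)
  qed
  have B0: "B 0 = 0" using centered[of "G m"] X0 by (simp add: B_def)
  have B_bound: "(p - 1) * s * N \<le> B s * H s powr g" if s: "0 \<le> s" for s
  proof (cases "s = 0")
    case True
    then show ?thesis by (simp add: B0)
  next
    case False
    with s have s: "s > 0" by simp
    define f where "f k = mat_inner n (G (X s k) - G m) (X s k - m)" for k
    define q where "q k = (schatten_power p m + schatten_power p (X s k)) / 2" for k
    \<comment> \<open>The constants make \<open>Y k powr (1 + g)\<close> the left side of the
      monotonicity inequality between m and m + s d_k.\<close>
    define Y where "Y k = ((p - 1) powr (p / 2) * s powr p) * schatten_power p (d k)" for k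
    have Y_powr: "((p - 1) powr (p / 2) * s powr p * c) powr (1 + g) = (p - 1) * s\<^sup>2 * c powr (2 / p)" if "c \<ge> 0" for c
      using p s that by (simp add: g powr_mult powr_powr)
    have mono: "(p - 1) * (s powr p * schatten_power p (d k)) powr (2 / p) \<le> f k * q k powr g" if k: "k < r" for k
    proof -
      have "X s k - m = complex_of_real s \<cdot>\<^sub>m d k" using m d[OF k] by (auto simp: X_def intro!: eq_matI)
      then have "schatten_power p (X s k - m) = s powr p * schatten_power p (d k)"
        using s schatten_power_smult[OF d[OF k], of p "complex_of_real s"] by simp
      then show ?thesis using monotone[OF m X[OF k], of s] by (simp add: f_def q_def g_def)
    qed
    have "(\<Sum>k<r. Y k) powr (1 + g) \<le> (\<Sum>k<r. f k) * (\<Sum>k<r. q k) powr g"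
    proof (rule reverse_Hoelder_sum)
      fix k assume "k \<in> {..<r}"
      then have k: "k < r" by simp
      show le: "Y k powr (1 + g) \<le> f k * q k powr g"
        using mono[OF k] p s schatten_power_nonneg[of p "d k"] unfolding Y_def Y_powr[OF schatten_power_nonneg]
        by (simp add: powr_mult powr_powr mult.assoc)
      have "mat_inner n (G (X s k)) (m - X s k) = - mat_inner n (G (X s k)) (X s k - m)"
        using m X[OF k, of s] by (intro mat_inner_diff_swap)
      moreover have "f k = mat_inner n (G (X s k)) (X s k - m) - mat_inner n (G m) (X s k - m)"
        unfolding f_def
        by (rule mat_inner_diff_left[OF G[OF X[OF k]] G[OF m] minus_carrier_mat[OF m]])
      ultimately have "p * f k = p * mat_inner n (G (X s k)) (X s k - m) - p * mat_inner n (G m) (X s k - m)"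
        "p * mat_inner n (G (X s k)) (m - X s k) = - (p * mat_inner n (G (X s k)) (X s k - m))"
        by (simp_all add: right_diff_distrib)
      \<comment> \<open>This is the sum of the convexity inequalities at \<open>m\<close> and at
        \<open>X s k\<close>.\<close>
      then have "p * f k \<ge> 0"
        using convex[OF m X[OF k], of s] convex[OF X[OF k] m, of s] by simp
      then show "0 \<le> f k" using p by (simp add: zero_le_mult_iff)
      show "0 \<le> q k" by (simp add: q_def schatten_power_nonneg)
      show "0 \<le> Y k" using schatten_power_nonneg[of p "d k"] by (simp add: Y_def)
    qed (use g in auto)
    also have "(\<Sum>k<r. f k) = s * (r * B s)"
    proof -
      have "f k = s * mat_inner n (G (X s k)) (d k) - s * mat_inner n (G m) (d k)" if k: "k < r" for k
      proof -
        have "f k = mat_inner n (G (X s k)) (X s k - X 0 k) - mat_inner n (G m) (X s k - X 0 k)"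
          unfolding f_def X0[OF k]
            by (rule mat_inner_diff_left[OF G[OF X[OF k]] G[OF m] minus_carrier_mat[OF m]])
        then show ?thesis by (simp add: inner_step[OF k])
      qed
      then have "(\<Sum>k<r. f k) = s * (\<Sum>k<r. mat_inner n (G (X s k)) (d k)) - s * (\<Sum>k<r. mat_inner n (G m) (d k))"
        by (simp add: sum_subtractf sum_distrib_left)
      then show ?thesis using r centered by (simp add: B_def)
    qed
    also have "(\<Sum>k<r. q k) = r * ((H 0 + H s) / 2)"
    proof -
      have "(\<Sum>k<r. q k) = (r * schatten_power p m + (\<Sum>k<r. schatten_power p (X s k))) / 2"
        by (simp add: q_def sum.distrib flip: sum_divide_distrib)
      then show ?thesis using r unfolding H0 by (simp add: H_def field_simps)
    qed
    finally have Hoelder: "(\<Sum>k<r. Y k) powr (1 + g) \<le> s * (r * B s) * (r * ((H 0 + H s) / 2)) powr g" .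
    have lhs: "(\<Sum>k<r. Y k) powr (1 + g) = (p - 1) * s\<^sup>2 * (real r powr (1 + g) * N)"
    proof -
      have "(\<Sum>k<r. Y k) powr (1 + g) = (p - 1) * s\<^sup>2 * (\<Sum>k<r. schatten_power p (d k)) powr (2 / p)"
        unfolding Y_def sum_distrib_left[symmetric] by (intro Y_powr sum_nonneg schatten_power_nonneg)
      also have "(\<Sum>k<r. schatten_power p (d k)) powr (2 / p) = real r powr (1 + g) * N"
        using r by (simp add: N_def g powr_divide sum_nonneg schatten_power_nonneg)
      finally show ?thesis .
    qed
    have rhs: "s * (r * B s) * (r * ((H 0 + H s) / 2)) powr g = s * B s * ((H 0 + H s) / 2) powr g * real r powr (1 + g)"
    proof -
      have "(r * ((H 0 + H s) / 2)) powr g = real r powr g * ((H 0 + H s) / 2) powr g"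
        by (rule powr_mult)
      then show ?thesis using r by (simp add: powr_add)
    qed
    have "(s * real r powr (1 + g)) * ((p - 1) * s * N) \<le> (s * real r powr (1 + g)) * (B s * ((H 0 + H s) / 2) powr g)"
      using Hoelder unfolding lhs rhs by (simp only: power2_eq_square mult_ac)
    then have 1: "(p - 1) * s * N \<le> B s * ((H 0 + H s) / 2) powr g"
      using s r by simp
    \<comment> \<open>As \<open>B 0 = 0\<close>, the mean power is least at s = 0, so the midpoint
      of \<open>H 0\<close> and \<open>H s\<close> may be replaced by \<open>H s\<close>.\<close>
    have "H 0 \<le> H s" using H_step[of 0 s] by (simp add: B0)
    moreover have "0 \<le> B s"
    proof -
      have "p * (s * B s) \<ge> 0" using H_step[of s 0] \<open>H 0 \<le> H s\<close> by (simp add: algebra_simps)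
      then show ?thesis using p s by (simp add: zero_le_mult_iff)
    qed
    ultimately have "B s * ((H 0 + H s) / 2) powr g \<le> B s * H s powr g"
      using H_nonneg[of 0] g by (intro mult_left_mono powr_mono2) auto
    with 1 show ?thesis by simp
  qed
  have "H 0 powr (2 / p) + (p - 1) * N \<le> H 1 powr (2 / p)"
  proof (rule quadratic_growth)
    fix s t :: real assume st: "0 \<le> s" "s < t"
    have "2 * ((p - 1) * N) * (t - s) * s = 2 * ((t - s) * ((p - 1) * s * N))" by (simp only: mult_ac)
    also have "\<dots> \<le> 2 * ((t - s) * (B s * H s powr g))"
      using st by (intro mult_left_mono B_bound) auto
    also have "\<dots> = 2 / p * H s powr g * (p * (t - s) * B s)"
      using p by (simp add: field_simps)
    also have "\<dots> \<le> 2 / p * H s powr g * (H t - H s)"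
      using p H_step[of s t] by (intro mult_left_mono) auto
    also have "\<dots> = 2 / p * H s powr (2 / p - 1) * (H t - H s)"
      using g(1) by (simp add: algebra_simps flip: g(1))
    \<comment> \<open>The tangent of x^(2/p) at \<open>H s\<close> turns the first-order bound for
      \<open>H\<close> into one for H^(2/p); here 2/p >= 1 enters.\<close>
    finally show "H s powr (2 / p) + 2 * ((p - 1) * N) * (t - s) * s \<le> H t powr (2 / p)"
      using powr_tangent[OF H_nonneg[of t] H_nonneg[of s], of "2 / p"] p by simp
  qed
  moreover have "X 1 k = m + d k" if "k < r" for k
    using m d[OF that] by (auto simp: X_def intro!: eq_matI)
  ultimately show ?thesis by (simp add: H0 H_def[of 1] N_def)
qed

section \<open>Splitting off frequencies\<close>

text \<open>The recursion for \<open>finsum\<close> applies to summands in the carrier; membership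
  and entries are proved in one induction because addition of entries uses the dimensions.\<close>

lemma mat_sum_carrier_index:
  fixes F :: "nat \<Rightarrow> complex mat"
  assumes "finite J" "\<And>k. k \<in> J \<Longrightarrow> F k \<in> carrier_mat n n"
  shows "mat_sum n F J \<in> carrier_mat n n
    \<and> (\<forall>i<n. \<forall>j<n. mat_sum n F J $$ (i, j) = (\<Sum>k\<in>J. F k $$ (i, j)))"
proof -
  interpret abelian_group "module_mat TYPE(complex) n n" by (rule abelian_group_mat)
  show ?thesis using assms
  proof (induction J rule: finite_induct)
    case empty
    then show ?case by (simp add: module_mat_simps)
  next
    case (insert x J)
    then have "mat_sum n F (insert x J) = F x + mat_sum n F J"
      using finsum_insert[of J x F] by (simp add: module_mat_simps Pi_def)
    moreover have "F x \<in> carrier_mat n n" "mat_sum n F J \<in> carrier_mat n n"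
      "\<And>i j. i < n \<Longrightarrow> j < n \<Longrightarrow> mat_sum n F J $$ (i, j) = (\<Sum>k\<in>J. F k $$ (i, j))"
      using insert by auto
    ultimately show ?case using insert.hyps by auto
  qed
qed

lemmas mat_sum_carrier = mat_sum_carrier_index[THEN conjunct1]

lemma mat_sum_index:
  assumes "finite J" "\<And>k. k \<in> J \<Longrightarrow> F k \<in> carrier_mat n n" "i < n" "j < n"
  shows "mat_sum n F J $$ (i, j) = (\<Sum>k\<in>J. F k $$ (i, j))"
  using mat_sum_carrier_index[of J F n] assms by blast

lemma cmod_root_of_unity: "cmod (root_of_unity r) = 1"
  by (simp add: root_of_unity_def)

lemma root_of_unity_power_eq_1:
  assumes "r \<ge> 1"
  shows "root_of_unity r ^ m = 1 \<longleftrightarrow> r dvd m"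
proof -
  have "root_of_unity r ^ m = exp (of_nat m * (2 * of_real pi * \<i> / of_nat r))"
    unfolding root_of_unity_def by (rule exp_of_nat_mult[symmetric])
  also have "of_nat m * (2 * of_real pi * \<i> / of_nat r) = 2 * of_real pi * \<i> * of_nat m / of_nat r" by simp
  finally show ?thesis using complex_root_unity_eq_1[OF assms, of m] by simp
qed

lemma cnj_root_of_unity_power:
  assumes "r \<ge> 1" "j \<le> r"
  shows "cnj (root_of_unity r ^ j) = root_of_unity r ^ (r - j)"
proof -
  let ?w = "root_of_unity r"
  have "cnj (?w ^ j) * ?w ^ j = 1" by (simp only: cnj_mult_self norm_power cmod_root_of_unity power_one of_real_1)
  moreover have "?w ^ (r - j) * ?w ^ j = 1"
    using assms root_of_unity_power_eq_1[OF assms(1), of r] by (simp flip: power_add)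
  moreover have "?w ^ j \<noteq> 0" using cmod_root_of_unity[of r] by auto
  ultimately show ?thesis by (metis mult_right_cancel)
qed

text \<open>A geometric sum with ratio \<open>z\<close>, where z^r = 1, and z = 1 exactly when i =
  j.\<close>

lemma root_of_unity_orthogonal:
  assumes "r \<ge> 1" "i < r" "j < r"
  shows "(\<Sum>k<r. cnj (root_of_unity r ^ (j * k)) * root_of_unity r ^ (i * k)) = (if i = j then of_nat r else 0)"
proof -
  let ?w = "root_of_unity r"
  \<comment> \<open>The exponent i - j is shifted by \<open>r\<close> to remain a natural number. It
    lies strictly between 0 and 2 r, so r divides it only if it equals r.\<close>
  define z where "z = ?w ^ (i + (r - j))"
  have "cnj (?w ^ (j * k)) * ?w ^ (i * k) = z ^ k" for k
  proof -
    have "cnj (?w ^ (j * k)) * ?w ^ (i * k) = (cnj (?w ^ j) * ?w ^ i) ^ k"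
      by (simp add: power_mult power_mult_distrib)
    also have "cnj (?w ^ j) * ?w ^ i = z"
      using assms by (simp only: cnj_root_of_unity_power less_imp_le z_def power_add mult.commute)
    finally show ?thesis .
  qed
  then have sum: "(\<Sum>k<r. cnj (?w ^ (j * k)) * ?w ^ (i * k)) = (\<Sum>k<r. z ^ k)" by simp
  have z1: "z = 1 \<longleftrightarrow> i = j"
  proof
    assume "z = 1"
    then have "r dvd i + (r - j)" using root_of_unity_power_eq_1[OF assms(1)] by (simp add: z_def)
    then obtain c where c: "i + (r - j) = r * c" by (elim dvdE)
    have "c = 1"
    proof (rule ccontr)
      assume "c \<noteq> 1"
      then consider "c = 0" | "c \<ge> 2" by linarith
      then show False
      proof cases
        case 1
        then show False using c assms by simp
      next
        case 2
        then have "r * 2 \<le> r * c" by simp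
        then show False using c assms by linarith
      qed
    qed
    then show "i = j" using c assms by simp
  next
    assume "i = j"
    then show "z = 1" using assms root_of_unity_power_eq_1[OF assms(1), of r] by (simp add: z_def)
  qed
  have "z ^ r = 1"
    using root_of_unity_power_eq_1[OF assms(1)] by (simp add: z_def flip: power_mult)
  then have "(1 - z) * (\<Sum>k<r. z ^ k) = 0"
    using one_diff_power_eq[of z r] by simp
  then show ?thesis unfolding sum using z1 by auto
qed

section \<open>Induction and averaging over orders of the frequencies\<close>

text \<open>Induction on the order \<open>l\<close> in which frequencies are split off. Multiplying
  the partial transform by the conjugate character of the head \<open>j\<close> keeps all norms and
  makes A_j its constant term. By orthogonality the rest has mean zero over \<open>k\<close>, so
  \<open>schatten_power_average\<close> applies, and its factor p - 1 raises every exponent in the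
  induction hypothesis by one.\<close>

lemma fourier_lower_bound_list:
  fixes p :: real and A :: "nat \<Rightarrow> complex mat"
  assumes p: "1 \<le> p" "p \<le> 2" and r: "r \<ge> 1"
    and A: "\<And>j. j < r \<Longrightarrow> A j \<in> carrier_mat n n"
    and l: "distinct l" "set l \<subseteq> {..<r}"
  shows "(\<Sum>i<length l. (p - 1) ^ i * schatten_power p (A (l ! i)) powr (2 / p))
    \<le> ((\<Sum>k<r. schatten_power p (mat_sum n (\<lambda>j. root_of_unity r ^ (j * k) \<cdot>\<^sub>m A j) (set l))) / r) powr (2 / p)"
  using l
proof (induction l)
  case Nil
  then show ?case by simp
next
  case (Cons j l)
  let ?e = "\<lambda>j k. root_of_unity r ^ (j * k)"
  define F where "F S k = mat_sum n (\<lambda>j. ?e j k \<cdot>\<^sub>m A j) S" for S k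
  define d where "d k = cnj (?e j k) \<cdot>\<^sub>m F (set l) k" for k
  have l: "distinct l" "set l \<subseteq> {..<r}" "j \<notin> set l" "j < r" using Cons.prems by auto
  have F_carrier: "F S k \<in> carrier_mat n n" if "S \<subseteq> {..<r}" for S k
    unfolding F_def using that A by (intro mat_sum_carrier) (auto intro: finite_subset)
  have F_index: "F S k $$ (a, b) = (\<Sum>i\<in>S. ?e i k * A i $$ (a, b))" if S: "S \<subseteq> {..<r}" and ab: "a < n" "b < n" for S k a b
  proof -
    have "F S k $$ (a, b) = (\<Sum>i\<in>S. (?e i k \<cdot>\<^sub>m A i) $$ (a, b))"
      unfolding F_def using S ab A by (intro mat_sum_index) (auto intro: finite_subset)
    also have "\<dots> = (\<Sum>i\<in>S. ?e i k * A i $$ (a, b))"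
    proof (intro sum.cong refl)
      fix i assume "i \<in> S"
      then have "A i \<in> carrier_mat n n" using S A by auto
      then show "(?e i k \<cdot>\<^sub>m A i) $$ (a, b) = ?e i k * A i $$ (a, b)" using ab by auto
    qed
    finally show ?thesis .
  qed
  have d: "d k \<in> carrier_mat n n" for k unfolding d_def using F_carrier[OF l(2)] by simp
  have phase: "cmod (cnj (?e i k)) = 1" for i k by (simp add: norm_power cmod_root_of_unity)
  have mean: "(\<Sum>k<r. d k $$ (a, b)) = 0" if ab: "a < n" "b < n" for a b
  proof -
    have "d k $$ (a, b) = cnj (?e j k) * F (set l) k $$ (a, b)" for k
      using ab F_carrier[OF l(2), of k] by (auto simp: d_def)
    then have "(\<Sum>k<r. d k $$ (a, b)) = (\<Sum>k<r. \<Sum>i\<in>set l. (cnj (?e j k) * ?e i k) * A i $$ (a, b))"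
      using ab by (simp only: F_index[OF l(2)] sum_distrib_left mult.assoc)
    also have "\<dots> = (\<Sum>i\<in>set l. (\<Sum>k<r. cnj (?e j k) * ?e i k) * A i $$ (a, b))"
      by (subst sum.swap) (simp only: sum_distrib_right)
    also have "\<dots> = 0"
    proof (intro sum.neutral ballI)
      fix i assume i: "i \<in> set l"
      then have "i < r" "i \<noteq> j" using l by auto
      then show "(\<Sum>k<r. cnj (?e j k) * ?e i k) * A i $$ (a, b) = 0"
        unfolding root_of_unity_orthogonal[OF r \<open>i < r\<close> l(4)] by simp
    qed
    finally show ?thesis .
  qed
  have shift: "schatten_power p (F (set (j # l)) k) = schatten_power p (A j + d k)" for k
  proof -
    have "cnj (?e j k) \<cdot>\<^sub>m F (set (j # l)) k = A j + d k"
    proof (rule eq_matI)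
      fix a b assume "a < dim_row (A j + d k)" "b < dim_col (A j + d k)"
      then have ab: "a < n" "b < n" using d[of k] by auto
      have "cnj (?e j k) * ?e j k = 1" by (simp only: cnj_mult_self norm_power cmod_root_of_unity power_one of_real_1)
      then have cancel: "cnj (?e j k) * (?e j k * c) = c" for c by (simp only: mult.assoc[symmetric] mult_1)
      have "(cnj (?e j k) \<cdot>\<^sub>m F (set (j # l)) k) $$ (a, b) = cnj (?e j k) * F (set (j # l)) k $$ (a, b)"
        using ab F_carrier[OF Cons.prems(2), of k] by auto
      also have "F (set (j # l)) k $$ (a, b) = ?e j k * A j $$ (a, b) + F (set l) k $$ (a, b)"
        unfolding F_index[OF Cons.prems(2) ab] F_index[OF l(2) ab] using l(3) by simp
      also have "cnj (?e j k) * \<dots> = A j $$ (a, b) + cnj (?e j k) * F (set l) k $$ (a, b)"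
        by (simp only: distrib_left cancel)
      also have "\<dots> = (A j + d k) $$ (a, b)"
        using ab d[of k] F_carrier[OF l(2), of k] by (auto simp: d_def)
      finally show "(cnj (?e j k) \<cdot>\<^sub>m F (set (j # l)) k) $$ (a, b) = (A j + d k) $$ (a, b)" .
    qed (use d[of k] F_carrier[OF Cons.prems(2), of k] in auto)
    then show ?thesis
      using schatten_power_smult[OF F_carrier[OF Cons.prems(2)], of p "cnj (?e j k)" k] phase by simp
  qed
  have d_power: "schatten_power p (d k) = schatten_power p (F (set l) k)" for k
    unfolding d_def using schatten_power_smult[OF F_carrier[OF l(2)], of p "cnj (?e j k)" k] phase by simp
  have "(\<Sum>i<length (j # l). (p - 1) ^ i * schatten_power p (A ((j # l) ! i)) powr (2 / p))
      = schatten_power p (A j) powr (2 / p) + (p - 1) * (\<Sum>i<length l. (p - 1) ^ i * schatten_power p (A (l ! i)) powr (2 / p))"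
    unfolding length_Cons sum.lessThan_Suc_shift sum_distrib_left by (simp add: mult.assoc)
  also have "\<dots> \<le> schatten_power p (A j) powr (2 / p) + (p - 1) * ((\<Sum>k<r. schatten_power p (d k)) / r) powr (2 / p)"
    using Cons.IH[OF l(1,2)] p unfolding d_power F_def by (intro add_left_mono mult_left_mono) auto
  also have "\<dots> \<le> ((\<Sum>k<r. schatten_power p (A j + d k)) / r) powr (2 / p)"
    using p r A[OF l(4)] d mean by (intro schatten_power_average) auto
  finally show ?case unfolding shift[symmetric] F_def .
qed

text \<open>Over all rotations, position \<open>i\<close> shows every entry once: entry
  \<open>i\<close> of the m-th rotation is entry \<open>m\<close> of the i-th.\<close>

lemma sum_rotate_nth:
  fixes f :: "'a \<Rightarrow> real"
  assumes "distinct xs" "i < length xs"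
  shows "(\<Sum>m<length xs. f (rotate m xs ! i)) = (\<Sum>x\<in>set xs. f x)"
proof -
  have "(\<Sum>m<length xs. f (rotate m xs ! i)) = (\<Sum>m<length xs. f (rotate i xs ! m))"
    using assms by (intro sum.cong refl) (simp add: nth_rotate add.commute)
  also have "\<dots> = sum_list (map f (rotate i xs))"
    by (simp add: sum_list_sum_nth atLeast0LessThan)
  also have "\<dots> = (\<Sum>x\<in>set xs. f x)"
    using assms by (simp add: sum_list_distinct_conv_sum_set)
  finally show ?thesis .
qed

text \<open>The factor 2 - p cancels against the geometric sum with ratio p - 1. For p = 2 every
  summand is 1, in agreement with the limit value.\<close>

lemma zeta_eq_average:
  assumes "r \<ge> 2"
  shows "real (r - 1) * zeta p r = (\<Sum>i<r - 1. (p - 1) ^ Suc i)"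
proof (cases "p = 2")
  case False
  have "1 - (p - 1) ^ (r - 1) = (2 - p) * (\<Sum>i<r - 1. (p - 1) ^ i)"
    using one_diff_power_eq[of "p - 1" "r - 1"] by simp
  then have "zeta p r = (p - 1) * (\<Sum>i<r - 1. (p - 1) ^ i) / real (r - 1)"
    using False assms by (simp add: zeta_def)
  then have "real (r - 1) * zeta p r = (p - 1) * (\<Sum>i<r - 1. (p - 1) ^ i)" using assms by simp
  then show ?thesis by (simp add: sum_distrib_left)
qed (simp add: zeta_def)

text \<open>Frequency 0 is split off first and receives coefficient 1. Averaging over the rotations
  of the others puts each of them at every later position once, so all receive the mean of the
  powers of p - 1, which is \<open>zeta p r\<close>.\<close>

lemma fourier_lower_bound:
  fixes p :: real and A :: "nat \<Rightarrow> complex mat"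
  assumes p: "1 \<le> p" "p \<le> 2" and r: "r \<ge> 2"
    and A: "\<And>j. j < r \<Longrightarrow> A j \<in> carrier_mat n n"
  shows "schatten_power p (A 0) powr (2 / p) + zeta p r * (\<Sum>k=1..r-1. schatten_power p (A k) powr (2 / p))
    \<le> ((\<Sum>k<r. schatten_power p (mat_sum n (\<lambda>j. root_of_unity r ^ (j * k) \<cdot>\<^sub>m A j) {..<r})) / r) powr (2 / p)"
    (is "?L \<le> ?W")
proof -
  define N where "N j = schatten_power p (A j) powr (2 / p)" for j
  define xs where "xs = [1..<r]"
  have xs: "distinct xs" "length xs = r - 1" "set xs = {1..r-1}" using r by (auto simp: xs_def)
  have each: "N 0 + (\<Sum>i<r - 1. (p - 1) ^ Suc i * N (rotate m xs ! i)) \<le> ?W" for m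
  proof -
    have "distinct (0 # rotate m xs)" and set: "set (0 # rotate m xs) = {..<r}"
      using r xs by auto
    then have "(\<Sum>i<length (0 # rotate m xs). (p - 1) ^ i * N ((0 # rotate m xs) ! i)) \<le> ?W"
      using fourier_lower_bound_list[of p r A n "0 # rotate m xs"] p r A unfolding N_def set by simp
    then show ?thesis
      unfolding length_Cons sum.lessThan_Suc_shift by (simp add: xs)
  qed
  have "(\<Sum>m<r - 1. N 0 + (\<Sum>i<r - 1. (p - 1) ^ Suc i * N (rotate m xs ! i))) \<le> (\<Sum>m<r - 1. ?W)"
    using each by (rule sum_mono)
  also have "(\<Sum>m<r - 1. N 0 + (\<Sum>i<r - 1. (p - 1) ^ Suc i * N (rotate m xs ! i)))
      = real (r - 1) * N 0 + (\<Sum>i<r - 1. (p - 1) ^ Suc i * (\<Sum>m<r - 1. N (rotate m xs ! i)))"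
    unfolding sum.distrib sum_distrib_left by (subst (2) sum.swap) simp
  also have "(\<Sum>i<r - 1. (p - 1) ^ Suc i * (\<Sum>m<r - 1. N (rotate m xs ! i)))
      = (\<Sum>i<r - 1. (p - 1) ^ Suc i) * (\<Sum>k=1..r-1. N k)"
    unfolding sum_distrib_right
  proof (rule sum.cong[OF refl])
    fix i assume "i \<in> {..<r - 1}"
    then show "(p - 1) ^ Suc i * (\<Sum>m<r - 1. N (rotate m xs ! i)) = (p - 1) ^ Suc i * (\<Sum>k=1..r-1. N k)"
      using sum_rotate_nth[OF xs(1), of i N] xs by simp
  qed
  also have "(\<Sum>i<r - 1. (p - 1) ^ Suc i) = real (r - 1) * zeta p r"
    using zeta_eq_average[OF r] by simp
  finally have "real (r - 1) * (N 0 + zeta p r * (\<Sum>k=1..r-1. N k)) \<le> real (r - 1) * ?W"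
    by (simp add: algebra_simps)
  then show ?thesis using r by (simp add: N_def)
qed

lemma schatten_norm_powr:
  assumes "p \<ge> 1"
  shows "schatten_norm p M powr p = schatten_power p M"
    "(schatten_norm p M)\<^sup>2 = schatten_power p M powr (2 / p)"
proof -
  have norm: "schatten_norm p M = schatten_power p M powr (1 / p)"
    by (simp add: schatten_norm_def schatten_power_def)
  show "schatten_norm p M powr p = schatten_power p M"
    using assms schatten_power_nonneg[of p M] by (simp add: norm powr_powr)
  show "(schatten_norm p M)\<^sup>2 = schatten_power p M powr (2 / p)"
    by (simp add: norm power2_eq_square flip: powr_add)
qed

section \<open>Fourier inversion and the two inequalities\<close>

text \<open>Exchanging the sums leaves the orthogonality relation of characters. \<open>B\<close>
  collects the matrices on the right of the first inequality, and their transform returns the family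
  on its left.\<close>

lemma fourier_inversion:
  fixes A :: "nat \<Rightarrow> complex mat"
  assumes r: "r \<ge> 1" and A: "\<And>j. j < r \<Longrightarrow> A j \<in> carrier_mat n n" and k: "k < r"
  defines "B \<equiv> \<lambda>j. (1 / of_nat r) \<cdot>\<^sub>m mat_sum n (\<lambda>l. cnj (root_of_unity r ^ (l * j)) \<cdot>\<^sub>m A l) {..<r}"
  shows "mat_sum n (\<lambda>j. root_of_unity r ^ (j * k) \<cdot>\<^sub>m B j) {..<r} = A k"
proof (rule eq_matI)
  have B: "B j \<in> carrier_mat n n" for j
    unfolding B_def using A by (intro smult_carrier_mat mat_sum_carrier) auto
  have C: "mat_sum n (\<lambda>j. root_of_unity r ^ (j * k) \<cdot>\<^sub>m B j) {..<r} \<in> carrier_mat n n"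
    using B by (intro mat_sum_carrier) auto
  show "dim_row (mat_sum n (\<lambda>j. root_of_unity r ^ (j * k) \<cdot>\<^sub>m B j) {..<r}) = dim_row (A k)"
    "dim_col (mat_sum n (\<lambda>j. root_of_unity r ^ (j * k) \<cdot>\<^sub>m B j) {..<r}) = dim_col (A k)"
    using C A[OF k] by auto
  fix a b assume "a < dim_row (A k)" "b < dim_col (A k)"
  then have ab: "a < n" "b < n" using A[OF k] by auto
  have B_index: "B j $$ (a, b) = (1 / of_nat r) * (\<Sum>l<r. cnj (root_of_unity r ^ (l * j)) * A l $$ (a, b))" for j
  proof -
    have "mat_sum n (\<lambda>l. cnj (root_of_unity r ^ (l * j)) \<cdot>\<^sub>m A l) {..<r} \<in> carrier_mat n n"
      using A by (intro mat_sum_carrier) auto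
    then have "B j $$ (a, b) = (1 / of_nat r) * mat_sum n (\<lambda>l. cnj (root_of_unity r ^ (l * j)) \<cdot>\<^sub>m A l) {..<r} $$ (a, b)"
      unfolding B_def using ab by simp
    also have "mat_sum n (\<lambda>l. cnj (root_of_unity r ^ (l * j)) \<cdot>\<^sub>m A l) {..<r} $$ (a, b)
        = (\<Sum>l<r. (cnj (root_of_unity r ^ (l * j)) \<cdot>\<^sub>m A l) $$ (a, b))"
      using A ab by (intro mat_sum_index) auto
    also have "\<dots> = (\<Sum>l<r. cnj (root_of_unity r ^ (l * j)) * A l $$ (a, b))"
      using A ab by (intro sum.cong refl) (metis carrier_matD index_smult_mat(1) lessThan_iff)
    finally show ?thesis .
  qed
  have "mat_sum n (\<lambda>j. root_of_unity r ^ (j * k) \<cdot>\<^sub>m B j) {..<r} $$ (a, b)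
      = (\<Sum>j<r. (root_of_unity r ^ (j * k) \<cdot>\<^sub>m B j) $$ (a, b))"
    using B ab by (intro mat_sum_index) auto
  also have "\<dots> = (\<Sum>j<r. root_of_unity r ^ (j * k) * B j $$ (a, b))"
    using B ab by (intro sum.cong refl) (metis carrier_matD index_smult_mat(1))
  also have "\<dots> = (1 / of_nat r) * (\<Sum>j<r. \<Sum>l<r. (cnj (root_of_unity r ^ (l * j)) * root_of_unity r ^ (k * j)) * A l $$ (a, b))"
    unfolding B_index sum_distrib_left by (simp add: mult_ac)
  also have "\<dots> = (1 / of_nat r) * (\<Sum>l<r. (\<Sum>j<r. cnj (root_of_unity r ^ (l * j)) * root_of_unity r ^ (k * j)) * A l $$ (a, b))"
    by (subst sum.swap) (simp only: sum_distrib_right)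
  also have "(\<Sum>l<r. (\<Sum>j<r. cnj (root_of_unity r ^ (l * j)) * root_of_unity r ^ (k * j)) * A l $$ (a, b))
      = (\<Sum>l<r. if l = k then of_nat r * A k $$ (a, b) else 0)"
    using root_of_unity_orthogonal[OF r k] by (intro sum.cong refl) auto
  also have "(1 / of_nat r) * \<dots> = A k $$ (a, b)" using k by simp
  finally show "mat_sum n (\<lambda>j. root_of_unity r ^ (j * k) \<cdot>\<^sub>m B j) {..<r} $$ (a, b) = A k $$ (a, b)" .
qed

lemma root_of_unity_powi_minus: "root_of_unity r powi (- int m) = cnj (root_of_unity r ^ m)"
proof -
  have "cnj (root_of_unity r ^ m) * root_of_unity r ^ m = 1"
    by (simp only: cnj_mult_self norm_power cmod_root_of_unity power_one of_real_1)
  then have "cnj (root_of_unity r ^ m) = inverse (root_of_unity r ^ m)"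
    by (metis inverse_unique mult.commute)
  then show ?thesis by (simp add: power_int_minus)
qed

text \<open>The second inequality is \<open>fourier_lower_bound\<close> for \<open>A\<close>. The
  first is the same bound for the normalised inverse transform \<open>B\<close>, whose transform is
  \<open>A\<close> and whose term at frequency 0 is the mean of \<open>A\<close>.\<close>

theorem theorem3p3:
  fixes r n :: nat and p :: real and A :: "nat \<Rightarrow> complex mat"
  assumes "r \<ge> 2"
    and "1 \<le> p" and "p \<le> 2"
    and "\<And>j. j < r \<Longrightarrow> A j \<in> carrier_mat n n"
  shows "(1 / real r * (\<Sum>j<r. schatten_norm p (A j) powr p)) powr (2 / p)
      \<ge> schatten_norm p ((1 / of_nat r) \<cdot>\<^sub>m mat_sum n A {..<r}) ^ 2
        + zeta p r * (\<Sum>k=1..r-1. schatten_norm p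
            ((1 / of_nat r) \<cdot>\<^sub>m
              mat_sum n (\<lambda>j. (root_of_unity r powi (- int (j * k))) \<cdot>\<^sub>m A j) {..<r}) ^ 2)
    \<and> (1 / real r * (\<Sum>k<r. schatten_norm p
            (mat_sum n (\<lambda>j. (root_of_unity r ^ (j * k)) \<cdot>\<^sub>m A j) {..<r}) powr p)) powr (2 / p)
      \<ge> schatten_norm p (A 0) ^ 2 + zeta p r * (\<Sum>k=1..r-1. schatten_norm p (A k) ^ 2)"
proof (rule conjI)
  note r = assms(1) and p = assms(2,3) and A = assms(4)
  have r1: "r \<ge> 1" using r by simp
  define B where "B j = (1 / of_nat r) \<cdot>\<^sub>m mat_sum n (\<lambda>l. cnj (root_of_unity r ^ (l * j)) \<cdot>\<^sub>m A l) {..<r}" for j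
  have B: "B j \<in> carrier_mat n n" for j
    unfolding B_def using A by (intro smult_carrier_mat mat_sum_carrier) auto
  have B0: "(1 / of_nat r) \<cdot>\<^sub>m mat_sum n A {..<r} = B 0"
  proof -
    have c: "mat_sum n A {..<r} \<in> carrier_mat n n" "mat_sum n (\<lambda>l. 1 \<cdot>\<^sub>m A l) {..<r} \<in> carrier_mat n n"
      using A by (auto intro!: mat_sum_carrier)
    have "mat_sum n (\<lambda>l. 1 \<cdot>\<^sub>m A l) {..<r} = mat_sum n A {..<r}"
    proof (rule eq_matI)
      fix a b assume "a < dim_row (mat_sum n A {..<r})" "b < dim_col (mat_sum n A {..<r})"
      then have ab: "a < n" "b < n" using c by auto
      have "mat_sum n (\<lambda>l. 1 \<cdot>\<^sub>m A l) {..<r} $$ (a, b) = (\<Sum>l<r. (1 \<cdot>\<^sub>m A l) $$ (a, b))"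
        using A ab by (intro mat_sum_index) auto
      also have "\<dots> = (\<Sum>l<r. A l $$ (a, b))"
        using A ab by (intro sum.cong refl) (metis carrier_matD index_smult_mat(1) lessThan_iff mult_1)
      also have "\<dots> = mat_sum n A {..<r} $$ (a, b)"
        using A ab by (intro mat_sum_index[symmetric]) auto
      finally show "mat_sum n (\<lambda>l. 1 \<cdot>\<^sub>m A l) {..<r} $$ (a, b) = mat_sum n A {..<r} $$ (a, b)" .
    qed (use c in auto)
    then show ?thesis by (simp add: B_def)
  qed
  have inv: "mat_sum n (\<lambda>j. root_of_unity r ^ (j * k) \<cdot>\<^sub>m B j) {..<r} = A k" if "k < r" for k
    unfolding B_def using fourier_inversion[OF r1 A that] .
  have "(\<Sum>k<r. schatten_power p (mat_sum n (\<lambda>j. root_of_unity r ^ (j * k) \<cdot>\<^sub>m B j) {..<r})) = (\<Sum>k<r. schatten_power p (A k))"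
    using inv by (intro sum.cong refl) simp
  then show "schatten_norm p ((1 / of_nat r) \<cdot>\<^sub>m mat_sum n A {..<r}) ^ 2
        + zeta p r * (\<Sum>k=1..r-1. schatten_norm p
            ((1 / of_nat r) \<cdot>\<^sub>m
              mat_sum n (\<lambda>j. (root_of_unity r powi (- int (j * k))) \<cdot>\<^sub>m A j) {..<r}) ^ 2)
      \<le> (1 / real r * (\<Sum>j<r. schatten_norm p (A j) powr p)) powr (2 / p)"
    using fourier_lower_bound[OF p r, of B n] B
    unfolding B0 root_of_unity_powi_minus B_def[symmetric] schatten_norm_powr[OF p(1)] by simp
  show "schatten_norm p (A 0) ^ 2 + zeta p r * (\<Sum>k=1..r-1. schatten_norm p (A k) ^ 2)
      \<le> (1 / real r * (\<Sum>k<r. schatten_norm p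
            (mat_sum n (\<lambda>j. (root_of_unity r ^ (j * k)) \<cdot>\<^sub>m A j) {..<r}) powr p)) powr (2 / p)"
    using fourier_lower_bound[OF p r, of A n] A
    unfolding schatten_norm_powr[OF p(1)] by simp
qed

end
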